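(* Let $\mathcal{M}=(M,\nabla)$ be an affine surface. \begin{enumerate} \item If $f\in\mathfrak{A}(\mathcal{M})$ and if $X\in\mathfrak{K}(\mathcal{M})$, then $X(f)\in\ker(H^\nabla)$, i.e. $X(f)\in\mathcal{Y}(\mathcal{M})$. \item If $h\in\ker(H^\nabla)$, then $R_{ij}(dh)=0$ for $1\le i<j\le m$, where $m=\dim M=2$. \end{enumerate}
   Context: An affine surface is a smooth surface $M$ with a torsion-free connection $\nabla$. $R(\xi_1,\xi_2)=\nabla_{\xi_1}\nabla_{\xi_2}-\nabla_{\xi_2}\nabla_{\xi_1}-\nabla_{[\xi_1,\xi_2]}$; $R_{ij}:=R(\partial_{x^i},\partial_{x^j})$ in local coordinates, acting on $1$-forms via the dual connection. $\rho(\xi_1,\xi_2)=\operatorname{Tr}\{\xi_3\mapsto R(\xi_3,\xi_1)\xi_2\}$ and $\rho^s$ is its symmetrization. The Hessian is $H_f^\nabla:=\nabla(df)$; $\ker(H^\nabla)=\{h\in C^\infty(M):H_h^\nabla=0\}=:\mathcal{Y}(\mathcal{M})$ (potentials of affine gradient Yamabe solitons). $\mathfrak{A}(\mathcal{M})=\{f\in C^\infty(M):H_f^\nabla+\rho^s=0\}$ (potentials of affine gradient Ricci solitons). $\mathfrak{K}(\mathcal{M})$ is the Lie algebra of affine Killing vector fields, i.e. vector fields $X$ with $\mathcal{L}_X\nabla=0$. *)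

theory Defs
  imports "HOL-Analysis.Analysis"
begin

section \<open>Smooth maps between Euclidean spaces\<close>

text \<open>These notions are only used on open sets \<open>S\<close>.\<close>

fun Ck_on :: "nat \<Rightarrow> 'a set \<Rightarrow> ('a::euclidean_space \<Rightarrow> 'b::real_normed_vector) \<Rightarrow> bool" where
  "Ck_on 0 S f \<longleftrightarrow> continuous_on S f"
| "Ck_on (Suc k) S f \<longleftrightarrow>
     f differentiable_on S \<and> (\<forall>b\<in>Basis. Ck_on k S (\<lambda>x. frechet_derivative f (at x) b))"

definition smooth_on :: "'a set \<Rightarrow> ('a::euclidean_space \<Rightarrow> 'b::real_normed_vector) \<Rightarrow> bool" where
  "smooth_on S f \<longleftrightarrow> (\<forall>k. Ck_on k S f)"


section \<open>Smooth surfaces\<close>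

text \<open>The underlying space of the surface \<open>M\<close> is a whole Hausdorff, second countable type \<open>'a\<close>,
  so points, functions and vector fields need no carrier set.  A chart is a pair \<open>(U, \<phi>)\<close>;
  only the values of \<open>\<phi>\<close> on \<open>U\<close> matter.\<close>

type_synonym 'a chart = "'a set \<times> ('a \<Rightarrow> real ^ 2)"

abbreviation dom_chart :: "'a chart \<Rightarrow> 'a set" where
  "dom_chart c \<equiv> fst c"

abbreviation chart_map :: "'a chart \<Rightarrow> 'a \<Rightarrow> real ^ 2" where
  "chart_map c \<equiv> snd c"

definition chart_inv :: "'a chart \<Rightarrow> real ^ 2 \<Rightarrow> 'a" where
  "chart_inv c = inv_into (dom_chart c) (chart_map c)"

definition is_chart :: "'a::topological_space chart \<Rightarrow> bool" where
  "is_chart c \<longleftrightarrow>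
     open (dom_chart c) \<and> open (chart_map c ` dom_chart c) \<and>
     homeomorphism (dom_chart c) (chart_map c ` dom_chart c) (chart_map c) (chart_inv c)"

definition compatible :: "'a chart \<Rightarrow> 'a chart \<Rightarrow> bool" where
  "compatible c d \<longleftrightarrow>
     smooth_on (chart_map c ` (dom_chart c \<inter> dom_chart d)) (chart_map d \<circ> chart_inv c) \<and>
     smooth_on (chart_map d ` (dom_chart c \<inter> dom_chart d)) (chart_map c \<circ> chart_inv d)"

text \<open>A smooth structure is a maximal smooth atlas, so that its members are exactly the local
  coordinate systems.\<close>

definition smooth_surface :: "'a::{t2_space,second_countable_topology} chart set \<Rightarrow> bool" where
  "smooth_surface A \<longleftrightarrow>
     (\<forall>c\<in>A. is_chart c) \<and>
     (\<forall>c\<in>A. \<forall>d\<in>A. compatible c d) \<and>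
     (\<Union>c\<in>A. dom_chart c) = UNIV \<and>
     (\<forall>c. is_chart c \<and> (\<forall>d\<in>A. compatible c d) \<longrightarrow> c \<in> A)"

definition smooth_fun_on ::
    "'a::topological_space chart set \<Rightarrow> 'a set \<Rightarrow> ('a \<Rightarrow> real) \<Rightarrow> bool" where
  "smooth_fun_on A U f \<longleftrightarrow>
     (\<forall>c\<in>A. smooth_on (chart_map c ` (U \<inter> dom_chart c)) (f \<circ> chart_inv c))"

definition smooth_funs :: "'a::topological_space chart set \<Rightarrow> ('a \<Rightarrow> real) set" where
  "smooth_funs A = {f. smooth_fun_on A UNIV f}"

definition smooth_near :: "'a::topological_space chart set \<Rightarrow> 'a \<Rightarrow> ('a \<Rightarrow> real) \<Rightarrow> bool" where
  "smooth_near A p f \<longleftrightarrow> (\<exists>U. open U \<and> p \<in> U \<and> smooth_fun_on A U f)"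


section \<open>Tangent vectors and vector fields\<close>

text \<open>A tangent vector at \<open>p\<close> acts on functions that are smooth near \<open>p\<close>.  It is normalised to
  vanish on all other functions, so that tangent vectors (and vector fields) that agree on smooth
  functions are equal.\<close>

type_synonym 'a tvec = "('a \<Rightarrow> real) \<Rightarrow> real"
type_synonym 'a vfield = "'a \<Rightarrow> 'a tvec"

definition coord_fun :: "'a chart \<Rightarrow> 2 \<Rightarrow> 'a \<Rightarrow> real" where
  "coord_fun c i p = chart_map c p $ i"

text \<open>The coordinate vector \<open>\<partial>/\<partial>x\<^sup>i\<close> at \<open>p\<close>.\<close>

definition coord_vec :: "'a::topological_space chart set \<Rightarrow> 'a chart \<Rightarrow> 2 \<Rightarrow> 'a vfield" where
  "coord_vec A c i p f =
     (if smooth_near A p f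
      then frechet_derivative (f \<circ> chart_inv c) (at (chart_map c p)) (axis i 1) else 0)"

definition tangent_space :: "'a::topological_space chart set \<Rightarrow> 'a \<Rightarrow> 'a tvec set" where
  "tangent_space A p =
     {v. \<exists>c\<in>A. p \<in> dom_chart c \<and>
        (\<exists>a :: real ^ 2. v = (\<lambda>f. \<Sum>i\<in>UNIV. a $ i * coord_vec A c i p f))}"

definition vector_fields :: "'a::topological_space chart set \<Rightarrow> 'a vfield set" where
  "vector_fields A =
     {X. (\<forall>p. X p \<in> tangent_space A p) \<and>
         (\<forall>c\<in>A. \<forall>i. smooth_fun_on A (dom_chart c) (\<lambda>p. X p (coord_fun c i)))}"

definition vf_apply :: "'a vfield \<Rightarrow> ('a \<Rightarrow> real) \<Rightarrow> 'a \<Rightarrow> real" where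
  "vf_apply X f = (\<lambda>p. X p f)"

definition vf_add :: "'a vfield \<Rightarrow> 'a vfield \<Rightarrow> 'a vfield" where
  "vf_add X Y = (\<lambda>p f. X p f + Y p f)"

definition vf_diff :: "'a vfield \<Rightarrow> 'a vfield \<Rightarrow> 'a vfield" where
  "vf_diff X Y = (\<lambda>p f. X p f - Y p f)"

definition vf_scale :: "('a \<Rightarrow> real) \<Rightarrow> 'a vfield \<Rightarrow> 'a vfield" where
  "vf_scale g X = (\<lambda>p f. g p * X p f)"

definition vf_zero :: "'a vfield" where
  "vf_zero = (\<lambda>p f. 0)"

definition lie_bracket ::
    "'a::topological_space chart set \<Rightarrow> 'a vfield \<Rightarrow> 'a vfield \<Rightarrow> 'a vfield" where
  "lie_bracket A X Y =
     (\<lambda>p f. if smooth_near A p f then X p (vf_apply Y f) - Y p (vf_apply X f) else 0)"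


section \<open>Torsion-free connections\<close>

type_synonym 'a conn = "'a vfield \<Rightarrow> 'a vfield \<Rightarrow> 'a vfield"

definition connection :: "'a::topological_space chart set \<Rightarrow> 'a conn \<Rightarrow> bool" where
  "connection A nabla \<longleftrightarrow>
     (\<forall>X\<in>vector_fields A. \<forall>Y\<in>vector_fields A. nabla X Y \<in> vector_fields A) \<and>
     (\<forall>X\<in>vector_fields A. \<forall>Y\<in>vector_fields A. \<forall>Z\<in>vector_fields A.
        nabla (vf_add X Y) Z = vf_add (nabla X Z) (nabla Y Z) \<and>
        nabla X (vf_add Y Z) = vf_add (nabla X Y) (nabla X Z)) \<and>
     (\<forall>g\<in>smooth_funs A. \<forall>X\<in>vector_fields A. \<forall>Y\<in>vector_fields A.
        nabla (vf_scale g X) Y = vf_scale g (nabla X Y) \<and>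
        nabla X (vf_scale g Y) =
          vf_add (vf_scale (vf_apply X g) Y) (vf_scale g (nabla X Y)))"

definition torsion_free :: "'a::topological_space chart set \<Rightarrow> 'a conn \<Rightarrow> bool" where
  "torsion_free A nabla \<longleftrightarrow>
     (\<forall>X\<in>vector_fields A. \<forall>Y\<in>vector_fields A.
        vf_diff (nabla X Y) (nabla Y X) = lie_bracket A X Y)"

definition affine_surface ::
    "'a::{t2_space,second_countable_topology} chart set \<Rightarrow> 'a conn \<Rightarrow> bool" where
  "affine_surface A nabla \<longleftrightarrow> smooth_surface A \<and> connection A nabla \<and> torsion_free A nabla"


section \<open>One-forms, the dual connection and the Hessian\<close>

text \<open>One-forms are regarded as maps from vector fields to functions.\<close>

type_synonym 'a form = "'a vfield \<Rightarrow> 'a \<Rightarrow> real"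

definition differential :: "('a \<Rightarrow> real) \<Rightarrow> 'a form" where
  "differential f = (\<lambda>X. vf_apply X f)"

definition dual_conn :: "'a conn \<Rightarrow> 'a vfield \<Rightarrow> 'a form \<Rightarrow> 'a form" where
  "dual_conn nabla X \<omega> = (\<lambda>Y p. vf_apply X (\<omega> Y) p - \<omega> (nabla X Y) p)"

definition hessian :: "'a conn \<Rightarrow> ('a \<Rightarrow> real) \<Rightarrow> 'a vfield \<Rightarrow> 'a vfield \<Rightarrow> 'a \<Rightarrow> real" where
  "hessian nabla f X Y = dual_conn nabla X (differential f) Y"


section \<open>Curvature\<close>

definition curvature ::
    "'a::topological_space chart set \<Rightarrow> 'a conn \<Rightarrow> 'a vfield \<Rightarrow> 'a vfield \<Rightarrow> 'a vfield \<Rightarrow> 'a vfield" where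
  "curvature A nabla X Y Z =
     vf_diff (vf_diff (nabla X (nabla Y Z)) (nabla Y (nabla X Z)))
             (nabla (lie_bracket A X Y) Z)"

definition curvature_form ::
    "'a::topological_space chart set \<Rightarrow> 'a conn \<Rightarrow> 'a vfield \<Rightarrow> 'a vfield \<Rightarrow> 'a form \<Rightarrow> 'a form" where
  "curvature_form A nabla X Y \<omega> = (\<lambda>Z p.
     dual_conn nabla X (dual_conn nabla Y \<omega>) Z p
     - dual_conn nabla Y (dual_conn nabla X \<omega>) Z p
     - dual_conn nabla (lie_bracket A X Y) \<omega> Z p)"

text \<open>Since \<open>R(X, Y)\<close> is tensorial in \<open>X\<close> and \<open>Y\<close>, it can be evaluated on tangent vectors at a point
  by extending these to arbitrary global vector fields.\<close>

definition extend :: "'a::topological_space chart set \<Rightarrow> 'a \<Rightarrow> 'a tvec \<Rightarrow> 'a vfield" where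
  "extend A p v = (SOME X. X \<in> vector_fields A \<and> X p = v)"

text \<open>\<open>R\<^sub>i\<^sub>j = R(\<partial>/\<partial>x\<^sup>i, \<partial>/\<partial>x\<^sup>j)\<close> acting on one-forms; meaningful at points of the domain of \<open>c\<close>.\<close>

definition curvature_form_coord ::
    "'a::topological_space chart set \<Rightarrow> 'a conn \<Rightarrow> 'a chart \<Rightarrow> 2 \<Rightarrow> 2 \<Rightarrow> 'a form \<Rightarrow> 'a form" where
  "curvature_form_coord A nabla c i j \<omega> = (\<lambda>Z p.
     curvature_form A nabla (extend A p (coord_vec A c i p)) (extend A p (coord_vec A c j p)) \<omega> Z p)"

text \<open>Trace of an endomorphism of the tangent space at \<open>p\<close>: the sum of the diagonal entries
  \<open>dx\<^sup>i(L (\<partial>/\<partial>x\<^sup>i))\<close> with respect to some (equivalently, any) chart around \<open>p\<close>.\<close>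

definition tangent_trace ::
    "'a::topological_space chart set \<Rightarrow> 'a \<Rightarrow> ('a tvec \<Rightarrow> 'a tvec) \<Rightarrow> real" where
  "tangent_trace A p L =
     (let c = (SOME c. c \<in> A \<and> p \<in> dom_chart c)
      in \<Sum>i\<in>UNIV. L (coord_vec A c i p) (coord_fun c i))"

definition ricci ::
    "'a::topological_space chart set \<Rightarrow> 'a conn \<Rightarrow> 'a vfield \<Rightarrow> 'a vfield \<Rightarrow> 'a \<Rightarrow> real" where
  "ricci A nabla X Y p = tangent_trace A p (\<lambda>v. curvature A nabla (extend A p v) X Y p)"

definition ricci_sym ::
    "'a::topological_space chart set \<Rightarrow> 'a conn \<Rightarrow> 'a vfield \<Rightarrow> 'a vfield \<Rightarrow> 'a \<Rightarrow> real" where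
  "ricci_sym A nabla X Y p = (ricci A nabla X Y p + ricci A nabla Y X p) / 2"


section \<open>Solitons and affine Killing vector fields\<close>

definition ker_hessian :: "'a::topological_space chart set \<Rightarrow> 'a conn \<Rightarrow> ('a \<Rightarrow> real) set" where
  "ker_hessian A nabla =
     {h \<in> smooth_funs A.
        \<forall>X\<in>vector_fields A. \<forall>Y\<in>vector_fields A. \<forall>p. hessian nabla h X Y p = 0}"

definition ricci_soliton_potentials ::
    "'a::topological_space chart set \<Rightarrow> 'a conn \<Rightarrow> ('a \<Rightarrow> real) set" where
  "ricci_soliton_potentials A nabla =
     {f \<in> smooth_funs A.
        \<forall>X\<in>vector_fields A. \<forall>Y\<in>vector_fields A. \<forall>p.
          hessian nabla f X Y p + ricci_sym A nabla X Y p = 0}"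

definition lie_derivative_conn ::
    "'a::topological_space chart set \<Rightarrow> 'a conn \<Rightarrow> 'a vfield \<Rightarrow> 'a vfield \<Rightarrow> 'a vfield \<Rightarrow> 'a vfield" where
  "lie_derivative_conn A nabla X Y Z =
     vf_diff (vf_diff (lie_bracket A X (nabla Y Z)) (nabla (lie_bracket A X Y) Z))
             (nabla Y (lie_bracket A X Z))"

definition affine_killing :: "'a::topological_space chart set \<Rightarrow> 'a conn \<Rightarrow> 'a vfield set" where
  "affine_killing A nabla =
     {X \<in> vector_fields A.
        \<forall>Y\<in>vector_fields A. \<forall>Z\<in>vector_fields A. lie_derivative_conn A nabla X Y Z = vf_zero}"

end

theory Submission
  imports Defs "HOL-Computational_Algebra.Polynomial"
begin

text \<open>
  Let \<open>X\<close> be affine Killing and write \<open>L\<close> for the Lie derivative along \<open>X\<close>. Since \<open>L\<close> preserves the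
  connection, it commutes with \<open>f \<mapsto> H\<^sub>f\<close> and annihilates the curvature, hence its trace \<open>\<rho>\<close> and \<open>\<rho>\<^sup>s\<close>.
  Applying \<open>L\<close> to \<open>H\<^sub>f + \<rho>\<^sup>s = 0\<close> gives \<open>H\<close> of \<open>X(f)\<close> equal to zero. For the second claim, \<open>H\<^sub>h = 0\<close> says
  that \<open>dh\<close> is parallel, and the curvature operator kills parallel forms.

  Vector fields are global here, so a coordinate frame has to be cut off by a bump function before
  the connection can be applied to it. The trace in \<open>\<rho>\<close> uses an arbitrary extension and an arbitrary
  chart at each point; tensoriality of the curvature identifies it near a given point with the trace
  in one fixed cut-off frame, and only then can it be differentiated.
\<close>


section \<open>Smooth maps between Euclidean spaces\<close>

lemma Ck_on_cong:
  assumes "open S" "\<And>x. x \<in> S \<Longrightarrow> f x = g x" "Ck_on k S f"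
  shows "Ck_on k S g"
  using assms(2,3)
proof (induction k arbitrary: f g)
  case 0
  then show ?case using continuous_on_cong by fastforce
next
  case (Suc k)
  have f: "f differentiable at x" if "x \<in> S" for x
    using Suc.prems(2) \<open>open S\<close> that by (auto simp: differentiable_on_eq_differentiable_at)
  have D: "(g has_derivative frechet_derivative f (at x)) (at x)" if "x \<in> S" for x
    using f[OF that, THEN frechet_derivative_works[THEN iffD1]] \<open>open S\<close> that Suc.prems(1)
    by (rule has_derivative_transform_within_open)
  have "frechet_derivative g (at x) = frechet_derivative f (at x)" if "x \<in> S" for x
    using frechet_derivative_at[OF D[OF that]] by simp
  then have "Ck_on k S (\<lambda>x. frechet_derivative g (at x) b)" if "b \<in> Basis" for b
    using Suc.IH[of "\<lambda>x. frechet_derivative f (at x) b"] Suc.prems(2) that by auto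
  then show ?case
    using D \<open>open S\<close> by (auto simp: differentiable_on_eq_differentiable_at differentiable_def)
qed

lemma Ck_on_subset:
  assumes "open S" "open T" "T \<subseteq> S" "Ck_on k S f"
  shows "Ck_on k T f"
  using assms(4)
proof (induction k arbitrary: f)
  case 0
  then show ?case using assms continuous_on_subset by auto
next
  case (Suc k)
  then show ?case using assms differentiable_on_subset by fastforce
qed

text \<open>Continuity, differentiability and \<open>frechet_derivative\<close> at a point see only
  a neighbourhood. This glues smoothness proofs carried out in different charts.\<close>

lemma Ck_on_local:
  assumes "open S" "\<And>x. x \<in> S \<Longrightarrow> \<exists>T. open T \<and> x \<in> T \<and> T \<subseteq> S \<and> Ck_on k T f"
  shows "Ck_on k S f"
  using assms(2)
proof (induction k arbitrary: f)
  case 0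
  have "continuous (at x) f" if "x \<in> S" for x
    using 0[OF that] by (auto simp: continuous_on_eq_continuous_at)
  then show ?case by (simp add: continuous_at_imp_continuous_on)
next
  case (Suc k)
  have "f differentiable at x" if "x \<in> S" for x
    using Suc.prems[OF that] by (auto simp: differentiable_on_eq_differentiable_at)
  moreover have "Ck_on k S (\<lambda>x. frechet_derivative f (at x) b)" if "b \<in> Basis" for b
    by (rule Suc.IH) (use Suc.prems that in fastforce)
  ultimately show ?case using \<open>open S\<close> by (auto simp: differentiable_on_eq_differentiable_at)
qed

text \<open>\<open>frechet_derivative\<close> is a choice operator; uniqueness of derivatives lets
  an explicit formula \<open>f'\<close> stand in for it, so that closure rules reduce to rules for
  \<open>has_derivative\<close>.\<close>

lemma Ck_on_SucI:
  assumes "open S" "\<And>x. x \<in> S \<Longrightarrow> (f has_derivative f' x) (at x)"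
    and "\<And>b. b \<in> Basis \<Longrightarrow> Ck_on k S (\<lambda>x. f' x b)"
  shows "Ck_on (Suc k) S f"
proof -
  have "frechet_derivative f (at x) = f' x" if "x \<in> S" for x
    using frechet_derivative_at[OF assms(2)[OF that]] by simp
  then have "Ck_on k S (\<lambda>x. frechet_derivative f (at x) b)" if "b \<in> Basis" for b
    using Ck_on_cong[OF \<open>open S\<close>, of "\<lambda>x. f' x b" "\<lambda>x. frechet_derivative f (at x) b"]
      assms(3) that by auto
  then show ?thesis
    using assms(1,2) by (auto simp: differentiable_on_eq_differentiable_at differentiable_def)
qed

lemma Ck_on_Suc_has_derivative:
  assumes "open S" "Ck_on (Suc k) S f" "x \<in> S"
  shows "(f has_derivative frechet_derivative f (at x)) (at x)"
  using assms frechet_derivative_works by (auto simp: differentiable_on_eq_differentiable_at)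

lemma Ck_on_SucD: "open S \<Longrightarrow> Ck_on (Suc k) S f \<Longrightarrow> Ck_on k S f"
proof (induction k arbitrary: f)
  case 0
  then show ?case by (auto intro: differentiable_imp_continuous_on)
next
  case (Suc k)
  then have "Ck_on k S (\<lambda>x. frechet_derivative f (at x) b)" if "b \<in> Basis" for b
    using that by auto
  then show ?case using Suc.prems by auto
qed

lemma Ck_on_const: "open S \<Longrightarrow> Ck_on k S (\<lambda>x. a)"
proof (induction k arbitrary: a)
  case (Suc k)
  show ?case
    by (rule Ck_on_SucI[where f' = "\<lambda>x h. 0"]) (use Suc in auto)
qed auto

lemma Ck_on_bounded_linear:
  assumes "open S" "bounded_linear h" "Ck_on k S f"
  shows "Ck_on k S (\<lambda>x. h (f x))"
  using assms(3)
proof (induction k arbitrary: f)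
  case 0
  then show ?case using assms(2) by (auto intro: bounded_linear.continuous_on)
next
  case (Suc k)
  show ?case
    by (rule Ck_on_SucI[where f' = "\<lambda>x b. h (frechet_derivative f (at x) b)"])
      (use assms Suc Ck_on_Suc_has_derivative[OF \<open>open S\<close> Suc.prems] in
        \<open>auto intro: bounded_linear.has_derivative\<close>)
qed

lemma Ck_on_id: "open S \<Longrightarrow> Ck_on k S (\<lambda>x. x)"
proof (cases k)
  case (Suc k)
  assume "open S"
  then show ?thesis unfolding Suc
    by (intro Ck_on_SucI[where f' = "\<lambda>x b. b"]) (auto intro: Ck_on_const)
qed auto

lemma Ck_on_add:
  assumes "open S" "Ck_on k S f" "Ck_on k S g"
  shows "Ck_on k S (\<lambda>x. f x + g x)"
  using assms(2,3)
proof (induction k arbitrary: f g)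
  case 0
  then show ?case by (auto intro: continuous_on_add)
next
  case (Suc k)
  show ?case
  proof (rule Ck_on_SucI[where f' = "\<lambda>x b. frechet_derivative f (at x) b + frechet_derivative g (at x) b"])
    fix x assume "x \<in> S"
    then show "((\<lambda>x. f x + g x) has_derivative
        (\<lambda>b. frechet_derivative f (at x) b + frechet_derivative g (at x) b)) (at x)"
      using Suc.prems by (intro has_derivative_add Ck_on_Suc_has_derivative[OF \<open>open S\<close>, of k])
  qed (use assms(1) Suc in auto)
qed

lemma Ck_on_sum:
  assumes "open S" "finite I" "\<And>i. i \<in> I \<Longrightarrow> Ck_on k S (f i)"
  shows "Ck_on k S (\<lambda>x. \<Sum>i\<in>I. f i x)"
  using assms(2,3)
  by (induction I rule: finite_induct) (auto intro: Ck_on_add Ck_on_const assms(1))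

lemma Ck_on_scaleR:
  assumes "open S" "Ck_on k S f" "Ck_on k S g"
  shows "Ck_on k S (\<lambda>x. f x *\<^sub>R g x)"
  using assms(2,3)
proof (induction k arbitrary: f g)
  case 0
  then show ?case by (auto intro: continuous_on_scaleR)
next
  case (Suc k)
  have fg: "Ck_on k S f" "Ck_on k S g"
    using Suc.prems Ck_on_SucD[OF \<open>open S\<close>] by auto
  show ?case
  proof (rule Ck_on_SucI[where f' = "\<lambda>x b. f x *\<^sub>R frechet_derivative g (at x) b
        + frechet_derivative f (at x) b *\<^sub>R g x"])
    fix x assume "x \<in> S"
    then show "((\<lambda>x. f x *\<^sub>R g x) has_derivative (\<lambda>b. f x *\<^sub>R frechet_derivative g (at x) b
        + frechet_derivative f (at x) b *\<^sub>R g x)) (at x)"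
      using Suc.prems by (intro has_derivative_scaleR Ck_on_Suc_has_derivative[OF \<open>open S\<close>, of k])
  next
    fix b :: 'a assume "b \<in> Basis"
    then show "Ck_on k S (\<lambda>x. f x *\<^sub>R frechet_derivative g (at x) b
        + frechet_derivative f (at x) b *\<^sub>R g x)"
      using Suc fg by (intro Ck_on_add Suc.IH \<open>open S\<close>) auto
  qed (rule \<open>open S\<close>)
qed

text \<open>Induction on \<open>k\<close> with \<open>g\<close> varying: by the chain rule a
  derivative of \<open>g \<circ> f\<close> is a sum of components of \<open>Df\<close> times partial
  derivatives of \<open>g\<close> composed with \<open>f\<close>, and the induction hypothesis
  covers those compositions.\<close>

lemma Ck_on_compose:
  assumes "open S" "open T" "f ` S \<subseteq> T" "Ck_on k S f" "Ck_on k T g"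
  shows "Ck_on k S (g \<circ> f)"
  using assms(4,5)
proof (induction k arbitrary: g)
  case 0
  then show ?case
    using assms(3) by (metis Ck_on.simps(1) continuous_on_compose continuous_on_subset)
next
  case (Suc k)
  note Df = Ck_on_Suc_has_derivative[OF \<open>open S\<close> Suc.prems(1)]
  note Dg = Ck_on_Suc_has_derivative[OF \<open>open T\<close> Suc.prems(2)]
  have fk: "Ck_on k S f" using Ck_on_SucD[OF \<open>open S\<close> Suc.prems(1)] .
  show ?case
  proof (rule Ck_on_SucI[OF \<open>open S\<close>])
    fix x assume x: "x \<in> S"
    then have "f x \<in> T" using assms(3) by auto
    have "linear (frechet_derivative g (at (f x)))"
      using Dg[OF \<open>f x \<in> T\<close>] has_derivative_linear by blast
    \<comment> \<open>\<open>Ck_on\<close> controls derivatives in basis directions only, so the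
      derivative of \<open>g\<close> in a general direction \<open>v\<close> is expanded over
      \<open>Basis\<close>.\<close>
    from linear_sum[OF this, of "\<lambda>i. (v \<bullet> i) *\<^sub>R i" Basis for v]
    have rep: "frechet_derivative g (at (f x)) v =
        (\<Sum>i\<in>Basis. (v \<bullet> i) *\<^sub>R frechet_derivative g (at (f x)) i)" for v
      unfolding euclidean_representation linear_scale[OF \<open>linear _\<close>] .
    have "frechet_derivative g (at (f x)) \<circ> frechet_derivative f (at x) =
      (\<lambda>b. \<Sum>i\<in>Basis. (frechet_derivative f (at x) b \<bullet> i) *\<^sub>R
        (((\<lambda>y. frechet_derivative g (at y) i) \<circ> f) x))"
      unfolding o_def by (rule ext) (rule rep)
    with diff_chain_at[OF Df[OF x] Dg[OF \<open>f x \<in> T\<close>]]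
    show "((g \<circ> f) has_derivative (\<lambda>b. \<Sum>i\<in>Basis. (frechet_derivative f (at x) b \<bullet> i) *\<^sub>R
        (((\<lambda>y. frechet_derivative g (at y) i) \<circ> f) x))) (at x)"
      by metis
  next
    fix b :: 'a assume b: "b \<in> Basis"
    show "Ck_on k S (\<lambda>x. \<Sum>i\<in>Basis. (frechet_derivative f (at x) b \<bullet> i) *\<^sub>R
        (((\<lambda>y. frechet_derivative g (at y) i) \<circ> f) x))"
    proof (intro Ck_on_sum Ck_on_scaleR \<open>open S\<close>)
      fix i :: 'b assume i: "i \<in> Basis"
      show "Ck_on k S (\<lambda>x. frechet_derivative f (at x) b \<bullet> i)"
        using Suc.prems(1) b
        by (intro Ck_on_bounded_linear[OF \<open>open S\<close> bounded_linear_inner_left]) auto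
      have "Ck_on k S ((\<lambda>y. frechet_derivative g (at y) i) \<circ> f)"
        using Suc.prems(2) i by (intro Suc.IH fk) auto
      then show "Ck_on k S (\<lambda>x. ((\<lambda>y. frechet_derivative g (at y) i) \<circ> f) x)"
        by (simp add: o_def)
    qed auto
  qed
qed

lemma smooth_on_cong: "open S \<Longrightarrow> (\<And>x. x \<in> S \<Longrightarrow> f x = g x) \<Longrightarrow> smooth_on S f \<Longrightarrow> smooth_on S g"
  unfolding smooth_on_def using Ck_on_cong by blast

lemma smooth_on_subset: "open S \<Longrightarrow> open T \<Longrightarrow> T \<subseteq> S \<Longrightarrow> smooth_on S f \<Longrightarrow> smooth_on T f"
  unfolding smooth_on_def using Ck_on_subset by blast

lemma smooth_on_local:
  assumes "open S" "\<And>x. x \<in> S \<Longrightarrow> \<exists>T. open T \<and> x \<in> T \<and> T \<subseteq> S \<and> smooth_on T f"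
  shows "smooth_on S f"
  using assms(2) unfolding smooth_on_def by (fast intro: Ck_on_local[OF \<open>open S\<close>])

lemma smooth_on_const: "open S \<Longrightarrow> smooth_on S (\<lambda>x. a)"
  unfolding smooth_on_def using Ck_on_const by blast

lemma smooth_on_id: "open S \<Longrightarrow> smooth_on S (\<lambda>x. x)"
  unfolding smooth_on_def using Ck_on_id by blast

lemma smooth_on_bounded_linear:
  "open S \<Longrightarrow> bounded_linear h \<Longrightarrow> smooth_on S f \<Longrightarrow> smooth_on S (\<lambda>x. h (f x))"
  unfolding smooth_on_def using Ck_on_bounded_linear by blast

lemma smooth_on_add: "open S \<Longrightarrow> smooth_on S f \<Longrightarrow> smooth_on S g \<Longrightarrow> smooth_on S (\<lambda>x. f x + g x)"
  unfolding smooth_on_def using Ck_on_add by blast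

lemma smooth_on_sum:
  "open S \<Longrightarrow> finite I \<Longrightarrow> (\<And>i. i \<in> I \<Longrightarrow> smooth_on S (f i)) \<Longrightarrow> smooth_on S (\<lambda>x. \<Sum>i\<in>I. f i x)"
  unfolding smooth_on_def by (simp add: Ck_on_sum)

lemma smooth_on_mult:
  fixes f g :: "'a::euclidean_space \<Rightarrow> real"
  shows "open S \<Longrightarrow> smooth_on S f \<Longrightarrow> smooth_on S g \<Longrightarrow> smooth_on S (\<lambda>x. f x * g x)"
  unfolding smooth_on_def using Ck_on_scaleR[of S _ f g] by simp

lemma smooth_on_compose:
  "open S \<Longrightarrow> open T \<Longrightarrow> f ` S \<subseteq> T \<Longrightarrow> smooth_on S f \<Longrightarrow> smooth_on T g \<Longrightarrow> smooth_on S (g \<circ> f)"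
  unfolding smooth_on_def using Ck_on_compose by blast

lemma smooth_on_frechet_derivative:
  "smooth_on S f \<Longrightarrow> b \<in> Basis \<Longrightarrow> smooth_on S (\<lambda>x. frechet_derivative f (at x) b)"
  unfolding smooth_on_def using Ck_on.simps(2) by blast

lemma smooth_on_has_derivative:
  assumes "open S" "smooth_on S f" "x \<in> S"
  shows "(f has_derivative frechet_derivative f (at x)) (at x)"
  using assms(2) Ck_on_Suc_has_derivative[OF assms(1) _ assms(3), of 0]
  unfolding smooth_on_def by blast

section \<open>Smooth bump functions\<close>

text \<open>The derivatives of \<open>exp (-1/t)\<close>, extended by \<open>0\<close> to \<open>t \<le> 0\<close>, are again of the form
  \<open>p (1/t) exp (-1/t)\<close> with a polynomial \<open>p\<close>.\<close>

definition flat_fun :: "real poly \<Rightarrow> real \<Rightarrow> real" where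
  "flat_fun p t = (if t > 0 then poly p (inverse t) * exp (- inverse t) else 0)"

text \<open>With \<open>x = 1/t\<close> this becomes the right-hand limit at 0 of the difference
  quotients of \<open>flat_fun\<close>.\<close>

lemma poly_times_exp_minus_tendsto_0: "((\<lambda>x::real. poly p x * exp (- x)) \<longlongrightarrow> 0) at_top"
proof -
  have "((\<lambda>x. \<Sum>i\<le>degree p. coeff p i * (x ^ i / exp x)) \<longlongrightarrow> (\<Sum>i\<le>degree p. coeff p i * 0)) at_top"
    by (intro tendsto_sum tendsto_mult tendsto_const tendsto_power_div_exp_0)
  then show ?thesis
    by (simp add: poly_altdef sum_divide_distrib exp_minus field_simps)
qed

text \<open>For \<open>t > 0\<close> differentiating \<open>1/t\<close> contributes the factor
  \<open>1/t^2\<close>, encoded by \<open>[:0, 0, 1:]\<close>; the exponential then gives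
  \<open>p\<close> and the polynomial gives \<open>- pderiv p\<close>. Only \<open>t = 0\<close>
  needs a limit.\<close>

lemma flat_fun_deriv:
  "(flat_fun p has_field_derivative flat_fun ([:0, 0, 1:] * (p - pderiv p)) t) (at t)"
proof -
  consider "t > 0" | "t < 0" | "t = 0" by linarith
  then show ?thesis
  proof cases
    case 1
    have "((\<lambda>t. poly p (inverse t) * exp (- inverse t)) has_field_derivative
        flat_fun ([:0, 0, 1:] * (p - pderiv p)) t) (at t)"
      using 1 unfolding flat_fun_def
      by (auto intro!: derivative_eq_intros simp: field_simps power2_eq_square)
    then show ?thesis
      by (rule has_field_derivative_transform_within_open[of _ _ _ "{0<..}"])
        (use 1 in \<open>auto simp: flat_fun_def\<close>)
  next
    case 2
    have "((\<lambda>t. 0) has_field_derivative flat_fun ([:0, 0, 1:] * (p - pderiv p)) t) (at t)"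
      using 2 by (simp add: flat_fun_def)
    then show ?thesis
      by (rule has_field_derivative_transform_within_open[of _ _ _ "{..<0}"])
        (use 2 in \<open>auto simp: flat_fun_def\<close>)
  next
    case 3
    have "((\<lambda>h. flat_fun p h / h) \<longlongrightarrow> 0) (at_left 0)"
      by (rule Lim_transform_eventually[OF tendsto_const])
        (auto simp: flat_fun_def eventually_at_filter)
    \<comment> \<open>Substituting \<open>x = 1/h\<close> turns the quotient into
      \<open>x * p(x) * exp(-x)\<close>, and \<open>pCons 0 p\<close> is the polynomial
      \<open>x * p(x)\<close>.\<close>
    moreover have "((\<lambda>h. flat_fun p h / h) \<longlongrightarrow> 0) (at_right 0)"
      unfolding filterlim_at_right_to_top
      by (rule Lim_transform_eventually[OF poly_times_exp_minus_tendsto_0[of "pCons 0 p"]],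
          rule eventually_mono[OF eventually_gt_at_top[of 0]])
        (auto simp: flat_fun_def divide_inverse mult_ac)
    ultimately have "((\<lambda>h. flat_fun p h / h) \<longlongrightarrow> 0) (at 0)"
      by (rule filterlim_split_at)
    then show ?thesis
      using 3 by (simp add: has_field_derivative_iff flat_fun_def)
  qed
qed

text \<open>The family of all \<open>flat_fun p\<close> is closed under differentiation, so the
  induction runs over all \<open>p\<close> at once.\<close>

lemma smooth_on_flat_fun: "smooth_on UNIV (flat_fun p)"
proof -
  have "Ck_on k UNIV (flat_fun p)" for k
  proof (induction k arbitrary: p)
    case 0
    have "isCont (flat_fun p) t" for t
      using flat_fun_deriv DERIV_isCont by blast
    then show ?case by (simp add: continuous_on_eq_continuous_at)
  next
    case (Suc k)
    show ?case
      by (rule Ck_on_SucI[OF _ flat_fun_deriv[of p, unfolded has_field_derivative_def]])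
        (use Suc in auto)
  qed
  then show ?thesis by (simp add: smooth_on_def)
qed

lemma smooth_step_exists:
  obtains \<phi> :: "real \<Rightarrow> real"
  where "smooth_on UNIV \<phi>" "\<And>t. t \<le> 0 \<Longrightarrow> \<phi> t = 0" "\<And>t. t \<ge> 1 \<Longrightarrow> \<phi> t = 1"
proof
  define f where "f = flat_fun 1"
  have f: "f t = (if t > 0 then exp (- inverse t) else 0)" for t
    by (simp add: f_def flat_fun_def)
  \<comment> \<open>\<open>f (f 1 - f t)\<close> is constantly \<open>f (f 1)\<close> for \<open>t \<le> 0\<close> and vanishes for \<open>t \<ge> 1\<close>; this avoids a quotient
    with a varying denominator.\<close>
  define \<phi> where "\<phi> t = 1 + (- 1 / f (f 1)) * (f \<circ> (\<lambda>s. f 1 + (- 1) * f s)) t" for t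
  have "smooth_on UNIV (f \<circ> (\<lambda>s. f 1 + (- 1) * f s))"
    unfolding f_def
    by (intro smooth_on_compose[OF open_UNIV open_UNIV subset_UNIV] smooth_on_add smooth_on_mult
        smooth_on_const smooth_on_flat_fun open_UNIV)
  then show "smooth_on UNIV \<phi>"
    unfolding \<phi>_def by (intro smooth_on_add smooth_on_mult smooth_on_const open_UNIV)
  have "f (f 1) > 0" by (simp add: f)
  then show "\<phi> t = 0" if "t \<le> 0" for t
    using that by (simp add: \<phi>_def f)
  show "\<phi> t = 1" if "t \<ge> 1" for t
  proof -
    \<comment> \<open>Monotonicity makes \<open>f 1 - f t\<close> nonpositive, where
      \<open>f\<close> vanishes.\<close>
    have "f 1 \<le> f t" using that by (simp add: f le_imp_inverse_le inverse_le_1_iff)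
    then show ?thesis by (simp add: \<phi>_def f)
  qed
qed

lemma smooth_bump_exists:
  fixes a :: "'a::euclidean_space"
  assumes "r > 0"
  obtains \<phi> :: "'a \<Rightarrow> real"
  where "smooth_on UNIV \<phi>" "\<And>x. x \<in> ball a r \<Longrightarrow> \<phi> x = 1" "\<And>x. x \<notin> cball a (2 * r) \<Longrightarrow> \<phi> x = 0"
proof -
  obtain \<psi> :: "real \<Rightarrow> real" where \<psi>: "smooth_on UNIV \<psi>"
    "\<And>t. t \<le> 0 \<Longrightarrow> \<psi> t = 0" "\<And>t. t \<ge> 1 \<Longrightarrow> \<psi> t = 1"
    using smooth_step_exists by blast
  \<comment> \<open>The constants give \<open>q = 1\<close> at distance \<open>r\<close> from
    \<open>a\<close> and \<open>q = 0\<close> at distance \<open>2 * r\<close>. Using the squared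
    distance keeps \<open>q\<close> smooth at \<open>a\<close> itself.\<close>
  define q where "q x = 4 / 3 + (- 1 / (3 * r\<^sup>2)) * (\<Sum>i\<in>Basis. ((x + (- a)) \<bullet> i) * ((x + (- a)) \<bullet> i))"
    for x :: 'a
  have q: "q x = 4 / 3 - (dist a x)\<^sup>2 / (3 * r\<^sup>2)" for x
  proof -
    have "(\<Sum>i\<in>Basis. ((x + (- a)) \<bullet> i) * ((x + (- a)) \<bullet> i)) = (dist a x)\<^sup>2"
      using euclidean_inner[of "x - a" "x - a"]
      by (simp add: dist_norm norm_minus_commute flip: power2_norm_eq_inner)
    then show ?thesis by (simp add: q_def)
  qed
  have "smooth_on UNIV (\<lambda>x. (x + (- a)) \<bullet> i)" for i
    by (intro smooth_on_bounded_linear[OF _ bounded_linear_inner_left]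
        smooth_on_add smooth_on_const smooth_on_id open_UNIV)
  then have "smooth_on UNIV q"
    unfolding q_def
    by (intro smooth_on_add smooth_on_mult smooth_on_sum smooth_on_const open_UNIV finite_Basis)
  then have "smooth_on UNIV (\<psi> \<circ> q)"
    using \<psi>(1) by (intro smooth_on_compose[where T = UNIV]) auto
  moreover have "(\<psi> \<circ> q) x = 1" if "x \<in> ball a r" for x
  proof -
    have "(dist a x)\<^sup>2 \<le> r\<^sup>2" using that by (intro power_mono) auto
    then show ?thesis using assms by (simp add: q \<psi>(3) field_simps)
  qed
  moreover have "(\<psi> \<circ> q) x = 0" if "x \<notin> cball a (2 * r)" for x
  proof -
    have "(2 * r)\<^sup>2 \<le> (dist a x)\<^sup>2" using that assms by (intro power_mono) auto
    then show ?thesis using assms by (simp add: q \<psi>(2) field_simps power2_eq_square)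
  qed
  ultimately show ?thesis using that by blast
qed


section \<open>Smooth functions on a surface\<close>

locale smooth_atlas =
  fixes A :: "'a::{t2_space,second_countable_topology} chart set"
  assumes smooth_surface: "smooth_surface A"
begin

section \<open>Charts and transition maps\<close>

lemma chart_at:
  obtains c where "c \<in> A" "p \<in> dom_chart c"
  using smooth_surface unfolding smooth_surface_def by blast

lemma chart_homeomorphism:
  assumes "c \<in> A"
  shows "homeomorphism (dom_chart c) (chart_map c ` dom_chart c) (chart_map c) (chart_inv c)"
    and "open (dom_chart c)" and "open (chart_map c ` dom_chart c)"
  using smooth_surface assms unfolding smooth_surface_def is_chart_def by auto

lemma chart_inv_chart_map [simp]: "c \<in> A \<Longrightarrow> p \<in> dom_chart c \<Longrightarrow> chart_inv c (chart_map c p) = p"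
  using chart_homeomorphism(1) homeomorphism_apply1 by blast

lemma open_chart_image:
  assumes "c \<in> A" "open U" "U \<subseteq> dom_chart c"
  shows "open (chart_map c ` U)"
proof -
  have "open (dom_chart c)" "open (chart_map c ` dom_chart c)"
    using assms(1) chart_homeomorphism by auto
  moreover have "openin (top_of_set (dom_chart c)) U"
    using assms by (simp add: openin_open_eq chart_homeomorphism(2))
  ultimately show ?thesis
    using homeomorphism_imp_open_map[OF chart_homeomorphism(1)[OF \<open>c \<in> A\<close>]]
    by (meson openin_open_eq)
qed

lemma open_dom_chart: "c \<in> A \<Longrightarrow> open (dom_chart c)"
  by (rule chart_homeomorphism(2))

lemma open_chart_image_Int: "c \<in> A \<Longrightarrow> open U \<Longrightarrow> open (chart_map c ` (U \<inter> dom_chart c))"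
  using open_chart_image[of c "U \<inter> dom_chart c"] open_dom_chart by blast

lemma smooth_transition:
  "c \<in> A \<Longrightarrow> d \<in> A \<Longrightarrow>
    smooth_on (chart_map c ` (dom_chart c \<inter> dom_chart d)) (chart_map d \<circ> chart_inv c)"
  using smooth_surface unfolding smooth_surface_def compatible_def by blast

text \<open>The definition quantifies over all charts, but one chart near each point is enough:
  passing to another chart composes with a smooth transition map.\<close>

lemma smooth_fun_onI:
  assumes "open U" and loc: "\<And>p. p \<in> U \<Longrightarrow>
      \<exists>c\<in>A. \<exists>V. open V \<and> p \<in> V \<and> V \<subseteq> U \<inter> dom_chart c \<and> smooth_on (chart_map c ` V) (f \<circ> chart_inv c)"
  shows "smooth_fun_on A U f"
  unfolding smooth_fun_on_def
proof
  fix d assume d: "d \<in> A"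
  show "smooth_on (chart_map d ` (U \<inter> dom_chart d)) (f \<circ> chart_inv d)"
  proof (rule smooth_on_local)
    show "open (chart_map d ` (U \<inter> dom_chart d))"
      using d assms(1) by (rule open_chart_image_Int)
  next
    fix x assume "x \<in> chart_map d ` (U \<inter> dom_chart d)"
    then obtain q where q: "q \<in> U" "q \<in> dom_chart d" "x = chart_map d q" by auto
    obtain c V where c: "c \<in> A" and V: "open V" "q \<in> V" "V \<subseteq> U \<inter> dom_chart c"
      "smooth_on (chart_map c ` V) (f \<circ> chart_inv c)"
      using loc[OF q(1)] by blast
    let ?T = "chart_map d ` (V \<inter> dom_chart d)"
    have opn: "open ?T" "open (chart_map d ` (dom_chart d \<inter> dom_chart c))" "open (chart_map c ` V)"
      using open_chart_image_Int[OF d V(1)] open_chart_image_Int[OF d open_dom_chart[OF c]]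
        open_chart_image[OF c V(1)] V(3) by (simp_all add: Int_commute)
    have "smooth_on ?T (chart_map c \<circ> chart_inv d)"
      by (rule smooth_on_subset[OF opn(2,1) _ smooth_transition[OF d c]]) (use V in auto)
    moreover have "(chart_map c \<circ> chart_inv d) ` ?T \<subseteq> chart_map c ` V"
      using d by auto
    ultimately have "smooth_on ?T ((f \<circ> chart_inv c) \<circ> (chart_map c \<circ> chart_inv d))"
      using V(4) opn by (intro smooth_on_compose) auto
    moreover have "((f \<circ> chart_inv c) \<circ> (chart_map c \<circ> chart_inv d)) x = (f \<circ> chart_inv d) x"
      if "x \<in> ?T" for x
      using that d c V(3) by auto
    ultimately have "smooth_on ?T (f \<circ> chart_inv d)"
      using smooth_on_cong[OF opn(1)] by blast
    then show "\<exists>T. open T \<and> x \<in> T \<and> T \<subseteq> chart_map d ` (U \<inter> dom_chart d) \<and> smooth_on T (f \<circ> chart_inv d)"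
      using opn(1) V(2,3) q by (intro exI[of _ ?T]) auto
  qed
qed

lemma smooth_fun_onD:
  "smooth_fun_on A U f \<Longrightarrow> c \<in> A \<Longrightarrow> smooth_on (chart_map c ` (U \<inter> dom_chart c)) (f \<circ> chart_inv c)"
  unfolding smooth_fun_on_def by (rule bspec)

lemma smooth_fun_on_subset:
  assumes "open U" "open V" "V \<subseteq> U" "smooth_fun_on A U f"
  shows "smooth_fun_on A V f"
proof (rule smooth_fun_onI[OF assms(2)])
  fix p assume p: "p \<in> V"
  obtain c where c: "c \<in> A" "p \<in> dom_chart c" by (rule chart_at)
  have "smooth_on (chart_map c ` (V \<inter> dom_chart c)) (f \<circ> chart_inv c)"
    by (rule smooth_on_subset[OF open_chart_image_Int[OF c(1) assms(1)]
          open_chart_image_Int[OF c(1) assms(2)] _ smooth_fun_onD[OF assms(4) c(1)]])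
      (use assms(3) in blast)
  then show "\<exists>c\<in>A. \<exists>W. open W \<and> p \<in> W \<and> W \<subseteq> V \<inter> dom_chart c \<and> smooth_on (chart_map c ` W) (f \<circ> chart_inv c)"
    using open_Int[OF assms(2) open_dom_chart[OF c(1)]] c(2) p by (blast intro!: bexI[OF _ c(1)])
qed

lemma smooth_fun_on_local:
  assumes "open U" "\<And>p. p \<in> U \<Longrightarrow> \<exists>V. open V \<and> p \<in> V \<and> V \<subseteq> U \<and> smooth_fun_on A V f"
  shows "smooth_fun_on A U f"
proof (rule smooth_fun_onI[OF assms(1)])
  fix p assume p: "p \<in> U"
  obtain c where c: "c \<in> A" "p \<in> dom_chart c" by (rule chart_at)
  obtain V where V: "open V" "p \<in> V" "V \<subseteq> U" "smooth_fun_on A V f" using assms(2)[OF p] by blast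
  have "smooth_on (chart_map c ` (V \<inter> dom_chart c)) (f \<circ> chart_inv c)"
    using V(4) c(1) by (rule smooth_fun_onD)
  then show "\<exists>c\<in>A. \<exists>W. open W \<and> p \<in> W \<and> W \<subseteq> U \<inter> dom_chart c \<and> smooth_on (chart_map c ` W) (f \<circ> chart_inv c)"
    using open_Int[OF V(1) open_dom_chart[OF c(1)]] c(2) V(2,3) by (blast intro!: bexI[OF _ c(1)])
qed

lemma smooth_fun_on_cong:
  assumes "open U" "\<And>p. p \<in> U \<Longrightarrow> f p = g p" "smooth_fun_on A U f"
  shows "smooth_fun_on A U g"
  unfolding smooth_fun_on_def
proof
  fix c assume c: "c \<in> A"
  show "smooth_on (chart_map c ` (U \<inter> dom_chart c)) (g \<circ> chart_inv c)"
    by (rule smooth_on_cong[OF open_chart_image_Int[OF c assms(1)] _ smooth_fun_onD[OF assms(3) c]])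
      (use assms(2) c in auto)
qed

lemma smooth_fun_on_const: "open U \<Longrightarrow> smooth_fun_on A U (\<lambda>p. a)"
  unfolding smooth_fun_on_def o_def
  by (auto intro!: smooth_on_const open_chart_image_Int)

lemma smooth_fun_on_add:
  "open U \<Longrightarrow> smooth_fun_on A U f \<Longrightarrow> smooth_fun_on A U g \<Longrightarrow> smooth_fun_on A U (\<lambda>p. f p + g p)"
  unfolding smooth_fun_on_def o_def
  by (auto intro!: smooth_on_add open_chart_image_Int)

lemma smooth_fun_on_mult:
  "open U \<Longrightarrow> smooth_fun_on A U f \<Longrightarrow> smooth_fun_on A U g \<Longrightarrow> smooth_fun_on A U (\<lambda>p. f p * g p)"
  unfolding smooth_fun_on_def o_def
  by (auto intro!: smooth_on_mult open_chart_image_Int)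

lemma smooth_fun_on_diff:
  "open U \<Longrightarrow> smooth_fun_on A U f \<Longrightarrow> smooth_fun_on A U g \<Longrightarrow> smooth_fun_on A U (\<lambda>p. f p - g p)"
  using smooth_fun_on_add[of U f "\<lambda>p. (- 1) * g p"] smooth_fun_on_mult[of U "\<lambda>_. - 1" g]
  by (simp add: smooth_fun_on_const)

lemma smooth_fun_on_coord_fun:
  assumes "c \<in> A" shows "smooth_fun_on A (dom_chart c) (coord_fun c i)"
proof (rule smooth_fun_onI)
  fix p assume "p \<in> dom_chart c"
  have "smooth_on (chart_map c ` dom_chart c) (\<lambda>x. x $ i)"
    by (intro smooth_on_bounded_linear[OF _ bounded_linear_vec_nth] smooth_on_id
        chart_homeomorphism(3) assms)
  then have "smooth_on (chart_map c ` dom_chart c) (coord_fun c i \<circ> chart_inv c)"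
    by (rule smooth_on_cong[OF chart_homeomorphism(3)[OF assms], rotated])
      (use assms in \<open>auto simp: coord_fun_def\<close>)
  then show "\<exists>c'\<in>A. \<exists>V. open V \<and> p \<in> V \<and> V \<subseteq> dom_chart c \<inter> dom_chart c' \<and>
      smooth_on (chart_map c' ` V) (coord_fun c i \<circ> chart_inv c')"
    using open_dom_chart[OF assms] \<open>p \<in> dom_chart c\<close> by (blast intro!: bexI[OF _ assms])
qed (rule open_dom_chart[OF assms])

section \<open>Smoothness near a point\<close>

lemma smooth_nearI: "open U \<Longrightarrow> p \<in> U \<Longrightarrow> smooth_fun_on A U f \<Longrightarrow> smooth_near A p f"
  unfolding smooth_near_def by blast

lemma smooth_near_coord_fun [simp, intro]:
  "c \<in> A \<Longrightarrow> p \<in> dom_chart c \<Longrightarrow> smooth_near A p (coord_fun c i)"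
  by (rule smooth_nearI[OF open_dom_chart _ smooth_fun_on_coord_fun])

lemma smooth_funs_imp_near [simp, intro]: "f \<in> smooth_funs A \<Longrightarrow> smooth_near A p f"
  unfolding smooth_funs_def by (auto intro: smooth_nearI[OF open_UNIV])

lemma smooth_near_common:
  assumes "smooth_near A p f" "smooth_near A p g"
  obtains U where "open U" "p \<in> U" "smooth_fun_on A U f" "smooth_fun_on A U g"
proof -
  obtain U V where *: "open U" "p \<in> U" "smooth_fun_on A U f" "open V" "p \<in> V" "smooth_fun_on A V g"
    using assms unfolding smooth_near_def by blast
  with that[of "U \<inter> V"] smooth_fun_on_subset[of U "U \<inter> V"] smooth_fun_on_subset[of V "U \<inter> V"]
  show ?thesis by auto
qed

lemma smooth_near_const [simp, intro]: "smooth_near A p (\<lambda>_. a)"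
  by (rule smooth_nearI[OF open_UNIV]) (auto intro: smooth_fun_on_const)

lemma smooth_near_add [intro]:
  "smooth_near A p f \<Longrightarrow> smooth_near A p g \<Longrightarrow> smooth_near A p (\<lambda>q. f q + g q)"
  by (metis smooth_near_common smooth_nearI smooth_fun_on_add)

lemma smooth_near_mult [intro]:
  "smooth_near A p f \<Longrightarrow> smooth_near A p g \<Longrightarrow> smooth_near A p (\<lambda>q. f q * g q)"
  by (metis smooth_near_common smooth_nearI smooth_fun_on_mult)

lemma smooth_near_diff [intro]:
  "smooth_near A p f \<Longrightarrow> smooth_near A p g \<Longrightarrow> smooth_near A p (\<lambda>q. f q - g q)"
  by (metis smooth_near_common smooth_nearI smooth_fun_on_diff)

lemma smooth_near_sum [intro]:
  "finite I \<Longrightarrow> (\<And>i. i \<in> I \<Longrightarrow> smooth_near A p (f i)) \<Longrightarrow> smooth_near A p (\<lambda>q. \<Sum>i\<in>I. f i q)"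
  by (induction I rule: finite_induct) (auto intro: smooth_near_add)

lemma smooth_near_cong:
  assumes "open V" "p \<in> V" "\<And>q. q \<in> V \<Longrightarrow> f q = g q" "smooth_near A p f"
  shows "smooth_near A p g"
proof -
  obtain U where U: "open U" "p \<in> U" "smooth_fun_on A U f"
    using assms(4) unfolding smooth_near_def by blast
  then have "smooth_fun_on A (U \<inter> V) f"
    using smooth_fun_on_subset[OF _ open_Int] assms(1) by blast
  then have "smooth_fun_on A (U \<inter> V) g"
    using smooth_fun_on_cong[OF open_Int[OF U(1) assms(1)], of f g] assms(3) by blast
  with open_Int[OF U(1) assms(1)] show ?thesis
    using U(2) assms(2) by (intro smooth_nearI[of "U \<inter> V"]) auto
qed

lemma smooth_funs_iff: "f \<in> smooth_funs A \<longleftrightarrow> (\<forall>p. smooth_near A p f)"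
proof
  assume f: "\<forall>p. smooth_near A p f"
  then show "f \<in> smooth_funs A"
    unfolding smooth_funs_def smooth_near_def by (auto intro: smooth_fun_on_local)
qed auto


subsection \<open>Tangent vectors\<close>

lemma smooth_near_has_derivative:
  assumes "c \<in> A" "p \<in> dom_chart c" "smooth_near A p f"
  shows "((f \<circ> chart_inv c) has_derivative frechet_derivative (f \<circ> chart_inv c) (at (chart_map c p)))
    (at (chart_map c p))"
proof -
  obtain U where U: "open U" "p \<in> U" "smooth_fun_on A U f"
    using assms(3) unfolding smooth_near_def by blast
  show ?thesis
    by (rule smooth_on_has_derivative[OF open_chart_image_Int[OF assms(1) U(1)]
          smooth_fun_onD[OF U(3) assms(1)]]) (use U(2) assms(2) in blast)
qed

lemma coord_vec_eqI:
  assumes "c \<in> A" "smooth_near A p f"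
    and "((f \<circ> chart_inv c) has_derivative f') (at (chart_map c p))"
  shows "coord_vec A c i p f = f' (axis i 1)"
  using assms frechet_derivative_at[OF assms(3)] by (simp add: coord_vec_def)

lemma coord_vec_not_smooth: "\<not> smooth_near A p f \<Longrightarrow> coord_vec A c i p f = 0"
  by (simp add: coord_vec_def)

text \<open>Because of the default value 0, functions that are not smooth near \<open>p\<close>
  count too. Smoothness near \<open>p\<close> depends only on the germ, so both sides take the same
  branch.\<close>

lemma coord_vec_cong:
  assumes "c \<in> A" "p \<in> dom_chart c" "open V" "p \<in> V" "\<And>q. q \<in> V \<Longrightarrow> f q = g q"
  shows "coord_vec A c i p f = coord_vec A c i p g"
proof (cases "smooth_near A p f")
  case True
  then have g: "smooth_near A p g" using assms smooth_near_cong[of V p f g] by auto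
  have "((g \<circ> chart_inv c) has_derivative frechet_derivative (f \<circ> chart_inv c) (at (chart_map c p)))
    (at (chart_map c p))"
    by (rule has_derivative_transform_within_open[OF smooth_near_has_derivative[OF assms(1,2) True]
          open_chart_image_Int[OF assms(1,3)]]) (use assms in auto)
  then show ?thesis using coord_vec_eqI[OF assms(1) g] True by (simp add: coord_vec_def)
next
  case False
  then have "\<not> smooth_near A p g" using assms smooth_near_cong[of V p g f] by auto
  with False show ?thesis by (simp add: coord_vec_def)
qed

lemma coord_vec_coord_fun:
  assumes "c \<in> A" "p \<in> dom_chart c"
  shows "coord_vec A c i p (coord_fun c j) = (if i = j then 1 else 0)"
proof -
  have "((\<lambda>x. x $ j) has_derivative (\<lambda>x. x $ j)) (at (chart_map c p))"
    by (rule bounded_linear_imp_has_derivative[OF bounded_linear_vec_nth])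
  then have "((coord_fun c j \<circ> chart_inv c) has_derivative (\<lambda>x. x $ j)) (at (chart_map c p))"
    by (rule has_derivative_transform_within_open[OF _ chart_homeomorphism(3)[OF assms(1)]])
      (use assms in \<open>auto simp: coord_fun_def\<close>)
  from coord_vec_eqI[OF assms(1) _ this] assms show ?thesis by (simp add: axis_def)
qed

lemma coord_vec_const: "c \<in> A \<Longrightarrow> coord_vec A c i p (\<lambda>_. a) = 0"
  by (subst coord_vec_eqI[where f' = "\<lambda>_. 0"]) (auto simp: o_def)

lemma coord_vec_add:
  assumes "c \<in> A" "p \<in> dom_chart c" "smooth_near A p f" "smooth_near A p g"
  shows "coord_vec A c i p (\<lambda>q. f q + g q) = coord_vec A c i p f + coord_vec A c i p g"
proof -
  have "(((\<lambda>q. f q + g q) \<circ> chart_inv c) has_derivative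
      (\<lambda>v. frechet_derivative (f \<circ> chart_inv c) (at (chart_map c p)) v
         + frechet_derivative (g \<circ> chart_inv c) (at (chart_map c p)) v)) (at (chart_map c p))"
    using has_derivative_add[OF smooth_near_has_derivative[OF assms(1-3)]
        smooth_near_has_derivative[OF assms(1,2,4)]] by (simp add: o_def)
  from coord_vec_eqI[OF assms(1) _ this] assms show ?thesis
    by (simp add: smooth_near_add) (simp add: coord_vec_def)
qed

lemma coord_vec_mult:
  assumes "c \<in> A" "p \<in> dom_chart c" "smooth_near A p f" "smooth_near A p g"
  shows "coord_vec A c i p (\<lambda>q. f q * g q) = coord_vec A c i p f * g p + f p * coord_vec A c i p g"
proof -
  have "(((\<lambda>q. f q * g q) \<circ> chart_inv c) has_derivative
      (\<lambda>v. f p * frechet_derivative (g \<circ> chart_inv c) (at (chart_map c p)) v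
         + frechet_derivative (f \<circ> chart_inv c) (at (chart_map c p)) v * g p)) (at (chart_map c p))"
    using has_derivative_mult[OF smooth_near_has_derivative[OF assms(1-3)]
        smooth_near_has_derivative[OF assms(1,2,4)]] assms by (simp add: o_def)
  from coord_vec_eqI[OF assms(1) _ this] assms show ?thesis
    by (simp add: smooth_near_mult) (simp add: coord_vec_def)
qed

text \<open>Chain rule for the transition map from \<open>d\<close> to \<open>c\<close>, whose
  Jacobian entries are the coordinate vectors of \<open>d\<close> applied to the coordinate
  functions of \<open>c\<close>. For \<open>f\<close> not smooth near \<open>p\<close> both sides
  are 0.\<close>

lemma coord_vec_change:
  assumes c: "c \<in> A" "p \<in> dom_chart c" and d: "d \<in> A" "p \<in> dom_chart d"
  shows "coord_vec A d k p f = (\<Sum>i\<in>UNIV. coord_vec A d k p (coord_fun c i) * coord_vec A c i p f)"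
proof (cases "smooth_near A p f")
  case True
  let ?x = "chart_map d p" and ?t = "chart_map c \<circ> chart_inv d"
  let ?D = "frechet_derivative ?t (at ?x)" and ?F = "frechet_derivative (f \<circ> chart_inv c) (at (chart_map c p))"
  let ?T = "chart_map d ` (dom_chart d \<inter> dom_chart c)"
  have T: "open ?T"
    using open_chart_image_Int[OF d(1) open_dom_chart[OF c(1)]] by (simp add: Int_commute)
  have t: "(?t has_derivative ?D) (at ?x)"
    by (rule smooth_on_has_derivative[OF T smooth_transition]) (use c d in auto)
  have *: "coord_vec A d k p (coord_fun c i) = ?D (axis k 1) $ i" for i
  proof (rule coord_vec_eqI)
    show "(coord_fun c i \<circ> chart_inv d has_derivative (\<lambda>v. ?D v $ i)) (at ?x)"
      using bounded_linear.has_derivative[OF bounded_linear_vec_nth t, of i]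
      by (simp add: o_def coord_fun_def)
  qed (use c d in auto)
  have F: "((f \<circ> chart_inv c) has_derivative ?F) (at (?t ?x))"
    using smooth_near_has_derivative[OF c True] d by simp
  have lin: "linear ?F" using F by (rule has_derivative_linear)
  have rep: "?F v = (\<Sum>i\<in>UNIV. v $ i * ?F (axis i 1))" for v
    using arg_cong[OF basis_expansion[of v], of ?F]
    unfolding linear_sum[OF lin] linear_scale[OF lin] scalar_mult_eq_scaleR real_scaleR_def
    by (rule sym)
  have "((f \<circ> chart_inv d) has_derivative (?F \<circ> ?D)) (at ?x)"
    by (rule has_derivative_transform_within_open[OF diff_chain_at[OF t F] T]) (use c d in auto)
  from coord_vec_eqI[OF d(1) True this] have "coord_vec A d k p f = ?F (?D (axis k 1))" by (simp only: o_def)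
  also have "\<dots> = (\<Sum>i\<in>UNIV. ?D (axis k 1) $ i * ?F (axis i 1))"
    by (rule rep)
  finally show ?thesis
    unfolding * using True by (simp add: coord_vec_def)
qed (simp add: coord_vec_not_smooth)

lemma smooth_fun_on_iff_near:
  assumes "open U"
  shows "smooth_fun_on A U f \<longleftrightarrow> (\<forall>p\<in>U. smooth_near A p f)"
proof
  assume near: "\<forall>p\<in>U. smooth_near A p f"
  show "smooth_fun_on A U f"
  proof (rule smooth_fun_on_local[OF assms])
    fix p assume "p \<in> U"
    with near obtain V where V: "open V" "p \<in> V" "smooth_fun_on A V f"
      unfolding smooth_near_def by blast
    then have "smooth_fun_on A (V \<inter> U) f"
      using smooth_fun_on_subset[OF V(1) open_Int[OF V(1) assms]] by blast
    then show "\<exists>V. open V \<and> p \<in> V \<and> V \<subseteq> U \<and> smooth_fun_on A V f"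
      using open_Int[OF V(1) assms] V(2) \<open>p \<in> U\<close> by blast
  qed
qed (use assms smooth_nearI in blast)

text \<open>On a neighbourhood where \<open>f\<close> is smooth the default branch of
  \<open>coord_vec\<close> is never taken, so the map read in the chart is a partial derivative of a
  smooth function.\<close>

lemma smooth_near_coord_vec:
  assumes c: "c \<in> A" "p \<in> dom_chart c" and f: "smooth_near A p f"
  shows "smooth_near A p (\<lambda>q. coord_vec A c i q f)"
proof -
  obtain U where U: "open U" "p \<in> U" "smooth_fun_on A U f"
    using f unfolding smooth_near_def by blast
  let ?V = "U \<inter> dom_chart c"
  have V: "open ?V" using open_Int[OF U(1) open_dom_chart[OF c(1)]] .
  have oi: "open (chart_map c ` ?V)" by (rule open_chart_image_Int[OF c(1) U(1)])
  have sm: "smooth_on (chart_map c ` ?V) (\<lambda>x. frechet_derivative (f \<circ> chart_inv c) (at x) (axis i 1))"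
    by (intro smooth_on_frechet_derivative smooth_fun_onD U(3) c(1)) simp
  have eq: "frechet_derivative (f \<circ> chart_inv c) (at x) (axis i 1)
      = ((\<lambda>q. coord_vec A c i q f) \<circ> chart_inv c) x" if "x \<in> chart_map c ` ?V" for x
    using that c U smooth_nearI[OF U(1) _ U(3)] by (auto simp: coord_vec_def)
  have *: "smooth_on (chart_map c ` ?V) ((\<lambda>q. coord_vec A c i q f) \<circ> chart_inv c)"
    by (rule smooth_on_cong[OF oi eq sm])
  have "smooth_fun_on A ?V (\<lambda>q. coord_vec A c i q f)"
    by (rule smooth_fun_onI[OF V]) (use c(1) V * in blast)
  then show ?thesis using smooth_nearI[OF V] U(2) c(2) by blast
qed

section \<open>Tangent spaces in arbitrary charts and the derivation rules\<close>

lemma tangent_spaceI: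
  assumes "c \<in> A" "p \<in> dom_chart c" "\<And>f. v f = (\<Sum>i\<in>UNIV. a i * coord_vec A c i p f)"
  shows "v \<in> tangent_space A p"
proof -
  have "v = (\<lambda>f. \<Sum>i\<in>UNIV. (\<chi> i. a i) $ i * coord_vec A c i p f)"
    using assms(3) by auto
  with assms(1,2) show ?thesis unfolding tangent_space_def by blast
qed

text \<open>Membership in \<open>tangent_space\<close> only provides some chart;
  \<open>coord_vec_change\<close> moves the expansion to any chart around \<open>p\<close>.\<close>

lemma tangent_space_coord:
  assumes "v \<in> tangent_space A p" and c: "c \<in> A" "p \<in> dom_chart c"
  shows "v f = (\<Sum>i\<in>UNIV. v (coord_fun c i) * coord_vec A c i p f)"
proof -
  obtain d a where d: "d \<in> A" "p \<in> dom_chart d"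
    and v: "v = (\<lambda>f. \<Sum>k\<in>UNIV. a $ k * coord_vec A d k p f)"
    using assms(1) unfolding tangent_space_def by blast
  have "v f = (\<Sum>k\<in>UNIV. a $ k * (\<Sum>i\<in>UNIV. coord_vec A d k p (coord_fun c i) * coord_vec A c i p f))"
    unfolding v coord_vec_change[OF c d, where f = f] ..
  also have "\<dots> = (\<Sum>i\<in>UNIV. v (coord_fun c i) * coord_vec A c i p f)"
    unfolding v by (simp add: sum_2 algebra_simps)
  finally show ?thesis .
qed

lemma tangent_space_combine:
  assumes "v \<in> tangent_space A p" "w \<in> tangent_space A p"
  shows "(\<lambda>f. a * v f + b * w f) \<in> tangent_space A p"
proof -
  obtain c where c: "c \<in> A" "p \<in> dom_chart c" by (rule chart_at)
  have "a * v f + b * w f =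
      (\<Sum>i\<in>UNIV. (a * v (coord_fun c i) + b * w (coord_fun c i)) * coord_vec A c i p f)" for f
    unfolding tangent_space_coord[OF assms(1) c, of f] tangent_space_coord[OF assms(2) c, of f]
    by (simp add: sum_2 algebra_simps)
  with c show ?thesis by (rule tangent_spaceI)
qed

lemma coord_vec_tangent: "c \<in> A \<Longrightarrow> p \<in> dom_chart c \<Longrightarrow> coord_vec A c i p \<in> tangent_space A p"
  by (rule tangent_spaceI[where a = "\<lambda>j. if j = i then 1 else 0"]) (auto simp: mult_if_delta)

lemma tangent_vec_cong:
  assumes "v \<in> tangent_space A p" "open V" "p \<in> V" "\<And>q. q \<in> V \<Longrightarrow> f q = g q"
  shows "v f = v g"
proof -
  obtain c where c: "c \<in> A" "p \<in> dom_chart c" by (rule chart_at)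
  show ?thesis
    using tangent_space_coord[OF assms(1) c, of f] tangent_space_coord[OF assms(1) c, of g]
      coord_vec_cong[OF c assms(2,3), of f g] assms(4) by simp
qed

lemma tangent_vec_const:
  assumes "v \<in> tangent_space A p" shows "v (\<lambda>_. a) = 0"
proof -
  obtain c where c: "c \<in> A" "p \<in> dom_chart c" by (rule chart_at)
  show ?thesis
    using tangent_space_coord[OF assms c, of "\<lambda>_. a"] coord_vec_const[OF c(1)] by simp
qed

lemma tangent_vec_add:
  assumes "v \<in> tangent_space A p" "smooth_near A p f" "smooth_near A p g"
  shows "v (\<lambda>q. f q + g q) = v f + v g"
proof -
  obtain c where c: "c \<in> A" "p \<in> dom_chart c" by (rule chart_at)
  show ?thesis
    using tangent_space_coord[OF assms(1) c, of f] tangent_space_coord[OF assms(1) c, of g]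
      tangent_space_coord[OF assms(1) c, of "\<lambda>q. f q + g q"] coord_vec_add[OF c assms(2,3)]
    by (simp add: sum_2 algebra_simps)
qed

lemma tangent_vec_mult:
  assumes "v \<in> tangent_space A p" "smooth_near A p f" "smooth_near A p g"
  shows "v (\<lambda>q. f q * g q) = v f * g p + f p * v g"
proof -
  obtain c where c: "c \<in> A" "p \<in> dom_chart c" by (rule chart_at)
  show ?thesis
    using tangent_space_coord[OF assms(1) c, of f] tangent_space_coord[OF assms(1) c, of g]
      tangent_space_coord[OF assms(1) c, of "\<lambda>q. f q * g q"] coord_vec_mult[OF c assms(2,3)]
    by (simp add: sum_2 algebra_simps)
qed

lemma tangent_vec_cmult:
  assumes "v \<in> tangent_space A p" "smooth_near A p f"
  shows "v (\<lambda>q. a * f q) = a * v f"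
  using tangent_vec_mult[OF assms(1) smooth_near_const assms(2)] tangent_vec_const[OF assms(1)] by simp

lemma tangent_vec_diff:
  assumes "v \<in> tangent_space A p" "smooth_near A p f" "smooth_near A p g"
  shows "v (\<lambda>q. f q - g q) = v f - v g"
  using tangent_vec_add[OF assms(1,2), of "\<lambda>q. (- 1) * g q"] tangent_vec_cmult[OF assms(1,3), of "- 1"]
    smooth_near_mult[OF smooth_near_const assms(3), of "- 1"] by simp


subsection \<open>Vector fields\<close>

lemma vector_fieldsD: "X \<in> vector_fields A \<Longrightarrow> X p \<in> tangent_space A p"
  unfolding vector_fields_def by blast

lemma smooth_near_vector_field_coord:
  assumes "X \<in> vector_fields A" "c \<in> A" "p \<in> dom_chart c"
  shows "smooth_near A p (\<lambda>q. X q (coord_fun c i))"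
proof -
  have "smooth_fun_on A (dom_chart c) (\<lambda>p. X p (coord_fun c i))"
    using assms(1,2) unfolding vector_fields_def by blast
  then show ?thesis using smooth_nearI[OF open_dom_chart[OF assms(2)] assms(3)] by blast
qed

text \<open>Formulated without membership in \<open>vector_fields\<close>, because
  \<open>vector_fieldsI\<close> uses it to establish that membership. Near \<open>p\<close> the
  function is the sum of the components times the partial derivatives of \<open>f\<close>.\<close>

lemma smooth_near_apply:
  assumes X: "\<And>q. X q \<in> tangent_space A q" and c: "c \<in> A" "p \<in> dom_chart c"
    and smooth: "\<And>i. smooth_near A p (\<lambda>q. X q (coord_fun c i))" and f: "smooth_near A p f"
  shows "smooth_near A p (\<lambda>q. X q f)"
proof (rule smooth_near_cong[OF open_dom_chart[OF c(1)] c(2)])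
  show "(\<Sum>i\<in>UNIV. X q (coord_fun c i) * coord_vec A c i q f) = X q f" if "q \<in> dom_chart c" for q
    by (rule tangent_space_coord[OF X c(1) that, symmetric])
  show "smooth_near A p (\<lambda>q. \<Sum>i\<in>UNIV. X q (coord_fun c i) * coord_vec A c i q f)"
    by (intro smooth_near_sum smooth_near_mult smooth smooth_near_coord_vec c f) simp
qed

lemma vector_fieldsI:
  assumes X: "\<And>p. X p \<in> tangent_space A p"
    and smooth: "\<And>p. \<exists>c\<in>A. p \<in> dom_chart c \<and> (\<forall>i. smooth_near A p (\<lambda>q. X q (coord_fun c i)))"
  shows "X \<in> vector_fields A"
proof -
  have "smooth_fun_on A (dom_chart d) (\<lambda>p. X p (coord_fun d j))" if d: "d \<in> A" for d j
    unfolding smooth_fun_on_iff_near[OF open_dom_chart[OF d]]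
  proof
    fix p assume p: "p \<in> dom_chart d"
    obtain c where c: "c \<in> A" "p \<in> dom_chart c" "\<And>i. smooth_near A p (\<lambda>q. X q (coord_fun c i))"
      using smooth by blast
    show "smooth_near A p (\<lambda>q. X q (coord_fun d j))"
      by (rule smooth_near_apply[OF X c smooth_near_coord_fun[OF d p]])
  qed
  with X show ?thesis unfolding vector_fields_def by blast
qed

lemma smooth_near_vf_apply:
  assumes X: "X \<in> vector_fields A" and f: "smooth_near A p f"
  shows "smooth_near A p (vf_apply X f)"
proof -
  obtain c where c: "c \<in> A" "p \<in> dom_chart c" by (rule chart_at)
  show ?thesis
    unfolding vf_apply_def
    by (rule smooth_near_apply[OF vector_fieldsD[OF X] c smooth_near_vector_field_coord[OF X c] f])
qed

lemma vf_apply_smooth_funs: "X \<in> vector_fields A \<Longrightarrow> f \<in> smooth_funs A \<Longrightarrow> vf_apply X f \<in> smooth_funs A"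
  by (simp add: smooth_funs_iff smooth_near_vf_apply)

lemma vf_add_vector_fields:
  assumes "X \<in> vector_fields A" "Y \<in> vector_fields A"
  shows "vf_add X Y \<in> vector_fields A"
proof (rule vector_fieldsI)
  fix p
  show "vf_add X Y p \<in> tangent_space A p"
    using tangent_space_combine[OF vector_fieldsD[OF assms(1), of p] vector_fieldsD[OF assms(2), of p],
        where a = 1 and b = 1] by (simp add: vf_add_def)
  obtain c where c: "c \<in> A" "p \<in> dom_chart c" by (rule chart_at)
  then show "\<exists>c\<in>A. p \<in> dom_chart c \<and> (\<forall>i. smooth_near A p (\<lambda>q. vf_add X Y q (coord_fun c i)))"
    using smooth_near_add[OF smooth_near_vector_field_coord[OF assms(1) c]
        smooth_near_vector_field_coord[OF assms(2) c]]
    by (auto simp: vf_add_def)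
qed

lemma vf_scale_vector_fields:
  assumes "g \<in> smooth_funs A" "X \<in> vector_fields A"
  shows "vf_scale g X \<in> vector_fields A"
proof (rule vector_fieldsI)
  fix p
  show "vf_scale g X p \<in> tangent_space A p"
    using tangent_space_combine[OF vector_fieldsD[OF assms(2), of p] vector_fieldsD[OF assms(2), of p],
        where a = "g p" and b = 0] by (simp add: vf_scale_def)
  obtain c where c: "c \<in> A" "p \<in> dom_chart c" by (rule chart_at)
  then show "\<exists>c\<in>A. p \<in> dom_chart c \<and> (\<forall>i. smooth_near A p (\<lambda>q. vf_scale g X q (coord_fun c i)))"
    using smooth_near_mult[OF smooth_funs_imp_near[OF assms(1)] smooth_near_vector_field_coord[OF assms(2) c]]
    by (auto simp: vf_scale_def)
qed

lemma vf_diff_conv: "vf_diff X Y = vf_add X (vf_scale (\<lambda>_. - 1) Y)"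
  by (simp add: vf_diff_def vf_add_def vf_scale_def)

lemma const_smooth_funs: "(\<lambda>_. a) \<in> smooth_funs A"
  by (simp add: smooth_funs_iff)

lemma mult_smooth_funs: "f \<in> smooth_funs A \<Longrightarrow> g \<in> smooth_funs A \<Longrightarrow> (\<lambda>p. f p * g p) \<in> smooth_funs A"
  by (auto simp: smooth_funs_iff)

lemma vf_diff_vector_fields:
  assumes "X \<in> vector_fields A" "Y \<in> vector_fields A"
  shows "vf_diff X Y \<in> vector_fields A"
  unfolding vf_diff_conv by (intro vf_add_vector_fields vf_scale_vector_fields const_smooth_funs assms)


subsection \<open>Cut-off coordinate frames\<close>

text \<open>The closed set \<open>K\<close> makes extension by zero smooth: a point of
  \<open>K\<close> lies in the open chart domain, and a point off \<open>K\<close> has the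
  complement of \<open>K\<close> as a neighbourhood on which \<open>\<phi>\<close> vanishes.\<close>

lemma bump_exists:
  assumes c: "c \<in> A" "p \<in> dom_chart c"
  obtains \<phi> V K where "\<phi> \<in> smooth_funs A" "open V" "p \<in> V" "V \<subseteq> dom_chart c"
    "\<And>q. q \<in> V \<Longrightarrow> \<phi> q = 1" "closed K" "K \<subseteq> dom_chart c" "\<And>q. q \<notin> K \<Longrightarrow> \<phi> q = 0"
proof -
  let ?x = "chart_map c p" and ?I = "chart_map c ` dom_chart c"
  note hom = chart_homeomorphism[OF c(1)]
  obtain e where e: "e > 0" "ball ?x e \<subseteq> ?I"
    using hom(3) c(2) by (meson image_eqI openE)
  \<comment> \<open>One third leaves room for the closed ball of radius \<open>2 * r\<close> inside
    the open ball of radius \<open>e\<close>.\<close>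
  define r where "r = e / 3"
  have r: "r > 0" "cball ?x (2 * r) \<subseteq> ?I"
    using e by (auto simp: r_def)
  obtain \<psi> :: "real ^ 2 \<Rightarrow> real" where \<psi>: "smooth_on UNIV \<psi>" "\<And>x. x \<in> ball ?x r \<Longrightarrow> \<psi> x = 1"
    "\<And>x. x \<notin> cball ?x (2 * r) \<Longrightarrow> \<psi> x = 0"
    using smooth_bump_exists[OF r(1)] by blast
  define \<phi> where "\<phi> q = (if q \<in> dom_chart c then \<psi> (chart_map c q) else 0)" for q
  define K where "K = chart_inv c ` cball ?x (2 * r)"
  define V where "V = dom_chart c \<inter> chart_map c -` ball ?x r"
  \<comment> \<open>\<open>K\<close> is a continuous image of a compact ball; since the surface is
    Hausdorff, it is closed in the whole surface and not merely in the chart domain.\<close>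
  have "compact K"
    unfolding K_def
    by (rule compact_continuous_image[OF continuous_on_subset[OF homeomorphism_cont2[OF hom(1)] r(2)]])
      (rule compact_cball)
  then have K: "closed K" by (rule compact_imp_closed)
  have Kc: "K \<subseteq> dom_chart c"
    using r(2) homeomorphism_image2[OF hom(1)] unfolding K_def by blast
  have \<phi>K: "\<phi> q = 0" if "q \<notin> K" for q
  proof (cases "q \<in> dom_chart c")
    case True
    have "chart_map c q \<notin> cball ?x (2 * r)"
    proof
      assume "chart_map c q \<in> cball ?x (2 * r)"
      then have "chart_inv c (chart_map c q) \<in> K" unfolding K_def by blast
      with that True c(1) show False by simp
    qed
    then show ?thesis using \<psi>(3) by (simp add: \<phi>_def)
  qed (simp add: \<phi>_def)
  have V: "open V"
    unfolding V_def using homeomorphism_cont1[OF hom(1)] hom(2)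
    by (intro continuous_open_preimage) auto
  have "smooth_on ?I (\<phi> \<circ> chart_inv c)"
    by (rule smooth_on_cong[OF hom(3) _ smooth_on_subset[OF open_UNIV hom(3) subset_UNIV \<psi>(1)]])
      (use c(1) in \<open>auto simp: \<phi>_def\<close>)
  then have \<phi>c: "smooth_fun_on A (dom_chart c) \<phi>"
    by (intro smooth_fun_onI hom(2)) (use c(1) hom(2) in blast)
  have "smooth_near A q \<phi>" for q
  proof (cases "q \<in> K")
    case True
    then show ?thesis using smooth_nearI[OF hom(2) _ \<phi>c] Kc by blast
  next
    case False
    then show ?thesis
      by (intro smooth_near_cong[OF open_Compl[OF K] _ _ smooth_near_const[of q 0]]) (auto simp: \<phi>K)
  qed
  then have \<phi>: "\<phi> \<in> smooth_funs A" unfolding smooth_funs_iff by (rule allI)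
  have "p \<in> V" "V \<subseteq> dom_chart c" using c(2) r(1) by (auto simp: V_def)
  moreover have "\<phi> q = 1" if "q \<in> V" for q
    using that \<psi>(2)[of "chart_map c q"] unfolding V_def \<phi>_def by simp
  ultimately show ?thesis by (rule that[OF \<phi> V _ _ _ K Kc \<phi>K])
qed

text \<open>The factor \<open>\<psi>\<close> is the square of a bump function \<open>\<phi>\<close>: one factor \<open>\<phi>\<close> makes the coordinate vector
  fields global, the other one makes the coefficients of \<open>X\<close> global.\<close>

lemma local_frame_exists:
  assumes c: "c \<in> A" "p \<in> dom_chart c"
  obtains V and E :: "2 \<Rightarrow> 'a vfield" and \<psi> and a :: "'a vfield \<Rightarrow> 2 \<Rightarrow> 'a \<Rightarrow> real"
  where "open V" "p \<in> V" "V \<subseteq> dom_chart c"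
    and "\<And>i. E i \<in> vector_fields A" and "\<And>i q. q \<in> V \<Longrightarrow> E i q = coord_vec A c i q"
    and "\<psi> \<in> smooth_funs A" and "\<And>q. q \<in> V \<Longrightarrow> \<psi> q = 1"
    and "\<And>X i. X \<in> vector_fields A \<Longrightarrow> a X i \<in> smooth_funs A"
    and "\<And>X i q. q \<in> V \<Longrightarrow> a X i q = X q (coord_fun c i)"
    and "\<And>X. X \<in> vector_fields A \<Longrightarrow>
      vf_scale \<psi> X = vf_add (vf_scale (a X 1) (E 1)) (vf_scale (a X 2) (E 2))"
proof -
  obtain \<phi> V K where \<phi>: "\<phi> \<in> smooth_funs A" and V: "open V" "p \<in> V" "V \<subseteq> dom_chart c"
    and \<phi>V: "\<And>q. q \<in> V \<Longrightarrow> \<phi> q = 1" and K: "closed K" "K \<subseteq> dom_chart c"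
    and \<phi>K: "\<And>q. q \<notin> K \<Longrightarrow> \<phi> q = 0"
    using bump_exists[OF c] by metis
  have ext_zero: "(\<lambda>q. \<phi> q * h q) \<in> smooth_funs A"
    if "\<And>q. q \<in> dom_chart c \<Longrightarrow> smooth_near A q h" for h
    unfolding smooth_funs_iff
  proof
    fix q
    show "smooth_near A q (\<lambda>q. \<phi> q * h q)"
    proof (cases "q \<in> K")
      case True
      then show ?thesis using K \<phi> that by (intro smooth_near_mult) auto
    next
      case False
      then show ?thesis
        by (intro smooth_near_cong[OF open_Compl[OF K(1)] _ _ smooth_near_const[of q 0]]) (auto simp: \<phi>K)
    qed
  qed
  define E where "E i = (\<lambda>q f. \<phi> q * coord_vec A c i q f)" for i
  define a where "a X i = (\<lambda>q. \<phi> q * X q (coord_fun c i))" for X :: "'a vfield" and i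
  have E: "E i \<in> vector_fields A" for i
  proof (rule vector_fieldsI)
    fix q
    obtain d where d: "d \<in> A" "q \<in> dom_chart d" by (rule chart_at)
    show "E i q \<in> tangent_space A q"
    proof (cases "q \<in> K")
      case True
      then have "coord_vec A c i q \<in> tangent_space A q" using K by (intro coord_vec_tangent c) auto
      from tangent_space_combine[OF this this, where a = "\<phi> q" and b = 0] show ?thesis
        by (simp add: E_def)
    next
      case False
      \<comment> \<open>Here \<open>q\<close> may lie outside the domain of \<open>c\<close>, so the
        zero vector is exhibited in the other chart \<open>d\<close>.\<close>
      then show ?thesis using d by (intro tangent_spaceI[where a = "\<lambda>_. 0"]) (auto simp: E_def \<phi>K)
    qed
    show "\<exists>c\<in>A. q \<in> dom_chart c \<and> (\<forall>j. smooth_near A q (\<lambda>q. E i q (coord_fun c j)))"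
    proof (cases "q \<in> K")
      case True
      then have q: "q \<in> dom_chart c" using K by blast
      have "smooth_near A q (\<lambda>q. E i q (coord_fun c j))" for j
        unfolding E_def
        by (intro smooth_near_mult smooth_funs_imp_near \<phi> smooth_near_coord_vec smooth_near_coord_fun c q)
      with c q show ?thesis by blast
    next
      case False
      have "smooth_near A q (\<lambda>q. E i q (coord_fun d j))" for j
        using False
        by (intro smooth_near_cong[OF open_Compl[OF K(1)] _ _ smooth_near_const[of q 0]])
          (auto simp: E_def \<phi>K)
      with d show ?thesis by blast
    qed
  qed
  have "a X i \<in> smooth_funs A" if "X \<in> vector_fields A" for X i
    unfolding a_def by (rule ext_zero) (rule smooth_near_vector_field_coord[OF that c(1)])
  \<comment> \<open>An equality of global fields, holding off \<open>K\<close> as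
    \<open>0 = 0\<close>; only such an equality can be substituted into the connection.\<close>
  moreover have "vf_scale (\<lambda>q. \<phi> q * \<phi> q) X = vf_add (vf_scale (a X 1) (E 1)) (vf_scale (a X 2) (E 2))"
    if X: "X \<in> vector_fields A" for X
  proof (intro ext)
    fix q f
    show "vf_scale (\<lambda>q. \<phi> q * \<phi> q) X q f = vf_add (vf_scale (a X 1) (E 1)) (vf_scale (a X 2) (E 2)) q f"
    proof (cases "q \<in> K")
      case True
      then have "q \<in> dom_chart c" using K by blast
      from tangent_space_coord[OF vector_fieldsD[OF X] c(1) this, of f] show ?thesis
        by (simp add: vf_scale_def vf_add_def a_def E_def sum_2 algebra_simps)
    qed (simp add: \<phi>K vf_scale_def vf_add_def a_def)
  qed
  ultimately show ?thesis
    using V E \<phi>V by (intro that[of V E "\<lambda>q. \<phi> q * \<phi> q" a])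
      (auto simp: E_def a_def intro: mult_smooth_funs \<phi>)
qed

text \<open>The choice in \<open>extend\<close> is justified by a witness: the combination of the
  cut-off frame with the components of \<open>v\<close> as constant coefficients.\<close>

lemma extend:
  assumes "v \<in> tangent_space A p"
  shows "extend A p v \<in> vector_fields A" and "extend A p v p = v"
proof -
  obtain c where c: "c \<in> A" "p \<in> dom_chart c" by (rule chart_at)
  obtain V and E :: "2 \<Rightarrow> 'a vfield" where V: "p \<in> V" and E: "\<And>i. E i \<in> vector_fields A"
    and EV: "\<And>i q. q \<in> V \<Longrightarrow> E i q = coord_vec A c i q"
    using local_frame_exists[OF c] by metis
  let ?X = "vf_add (vf_scale (\<lambda>_. v (coord_fun c 1)) (E 1)) (vf_scale (\<lambda>_. v (coord_fun c 2)) (E 2))"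
  have "?X \<in> vector_fields A"
    by (intro vf_add_vector_fields vf_scale_vector_fields const_smooth_funs E)
  moreover have "?X p = v"
    using tangent_space_coord[OF assms c, symmetric]
    by (auto simp: vf_add_def vf_scale_def EV[OF V] sum_2)
  ultimately have "?X \<in> vector_fields A \<and> ?X p = v" by (rule conjI)
  then have "extend A p v \<in> vector_fields A \<and> extend A p v p = v"
    unfolding extend_def by (rule someI[where P = "\<lambda>X. X \<in> vector_fields A \<and> X p = v"])
  then show "extend A p v \<in> vector_fields A" and "extend A p v p = v" by auto
qed

end


section \<open>Affine surfaces\<close>

locale affine_connection = smooth_atlas A
  for A :: "'a::{t2_space,second_countable_topology} chart set" +
  fixes nabla :: "'a conn"
  assumes connection: "connection A nabla" and torsion_free: "torsion_free A nabla"
begin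

abbreviation "VF \<equiv> vector_fields A"
abbreviation "br \<equiv> lie_bracket A"
abbreviation "R \<equiv> curvature A nabla"

section \<open>Rules for the connection and the Lie bracket\<close>

lemma nabla_vector_fields: "X \<in> VF \<Longrightarrow> Y \<in> VF \<Longrightarrow> nabla X Y \<in> VF"
  using connection unfolding connection_def by blast

lemma nabla_add_left:
  "X \<in> VF \<Longrightarrow> Y \<in> VF \<Longrightarrow> Z \<in> VF \<Longrightarrow> nabla (vf_add X Y) Z = vf_add (nabla X Z) (nabla Y Z)"
  using connection unfolding connection_def by blast

lemma nabla_add_right:
  "X \<in> VF \<Longrightarrow> Y \<in> VF \<Longrightarrow> Z \<in> VF \<Longrightarrow> nabla X (vf_add Y Z) = vf_add (nabla X Y) (nabla X Z)"
  using connection unfolding connection_def by blast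

lemma nabla_scale_left:
  "g \<in> smooth_funs A \<Longrightarrow> X \<in> VF \<Longrightarrow> Y \<in> VF \<Longrightarrow> nabla (vf_scale g X) Y = vf_scale g (nabla X Y)"
  using connection unfolding connection_def by blast

lemma nabla_scale_right:
  "g \<in> smooth_funs A \<Longrightarrow> X \<in> VF \<Longrightarrow> Y \<in> VF \<Longrightarrow>
    nabla X (vf_scale g Y) = vf_add (vf_scale (vf_apply X g) Y) (vf_scale g (nabla X Y))"
  using connection unfolding connection_def by blast

lemma nabla_diff_left:
  assumes "X \<in> VF" "Y \<in> VF" "Z \<in> VF"
  shows "nabla (vf_diff X Y) Z = vf_diff (nabla X Z) (nabla Y Z)"
  unfolding vf_diff_conv using assms
  by (simp add: nabla_add_left nabla_scale_left const_smooth_funs vf_scale_vector_fields)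

text \<open>Torsion-freeness reduces the bracket to the connection; closure and the product rules
  for brackets then follow from the connection axioms without coordinates.\<close>

lemma lie_bracket_conv: "X \<in> VF \<Longrightarrow> Y \<in> VF \<Longrightarrow> br X Y = vf_diff (nabla X Y) (nabla Y X)"
  using torsion_free unfolding torsion_free_def by simp

lemma lie_bracket_vector_fields: "X \<in> VF \<Longrightarrow> Y \<in> VF \<Longrightarrow> br X Y \<in> VF"
  by (simp add: lie_bracket_conv vf_diff_vector_fields nabla_vector_fields)

lemmas vf_closed = nabla_vector_fields lie_bracket_vector_fields vf_add_vector_fields
  vf_diff_vector_fields vf_scale_vector_fields

lemma curvature_vector_fields: "X \<in> VF \<Longrightarrow> Y \<in> VF \<Longrightarrow> Z \<in> VF \<Longrightarrow> R X Y Z \<in> VF"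
  unfolding curvature_def by (intro vf_closed)

lemma lie_bracket_add_left:
  "X \<in> VF \<Longrightarrow> Y \<in> VF \<Longrightarrow> Z \<in> VF \<Longrightarrow> br (vf_add X Y) Z = vf_add (br X Z) (br Y Z)"
  by (simp add: lie_bracket_conv vf_closed nabla_add_left nabla_add_right)
    (simp add: vf_add_def vf_diff_def fun_eq_iff)

lemma lie_bracket_scale_left:
  "g \<in> smooth_funs A \<Longrightarrow> X \<in> VF \<Longrightarrow> Y \<in> VF \<Longrightarrow>
    br (vf_scale g X) Y = vf_diff (vf_scale g (br X Y)) (vf_scale (vf_apply Y g) X)"
  by (simp add: lie_bracket_conv vf_closed nabla_scale_left nabla_scale_right)
    (simp add: vf_add_def vf_diff_def vf_scale_def fun_eq_iff algebra_simps)

lemma lie_bracket_apply: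
  "smooth_near A p f \<Longrightarrow> br X Y p f = X p (vf_apply Y f) - Y p (vf_apply X f)"
  by (simp add: lie_bracket_def)

lemma lie_bracket_diff_right:
  assumes "X \<in> VF" "Y \<in> VF" "Z \<in> VF"
  shows "br X (vf_diff Y Z) = vf_diff (br X Y) (br X Z)"
proof (intro ext)
  fix p f
  show "br X (vf_diff Y Z) p f = vf_diff (br X Y) (br X Z) p f"
  proof (cases "smooth_near A p f")
    case True
    have "X p (vf_apply (vf_diff Y Z) f) = X p (vf_apply Y f) - X p (vf_apply Z f)"
      using tangent_vec_diff[OF vector_fieldsD[OF assms(1)] smooth_near_vf_apply[OF assms(2) True]
          smooth_near_vf_apply[OF assms(3) True]]
      by (simp add: vf_apply_def vf_diff_def)
    then show ?thesis using True by (simp add: lie_bracket_apply vf_diff_def)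
  qed (simp add: lie_bracket_def vf_diff_def)
qed

text \<open>Since \<open>v\<close> sees germs, the commutator formula is needed on a neighbourhood
  of \<open>p\<close>; it holds wherever \<open>f\<close> is smooth.\<close>

lemma tangent_vec_lie_bracket:
  assumes v: "v \<in> tangent_space A p" and XY: "X \<in> VF" "Y \<in> VF" and f: "smooth_near A p f"
  shows "v (vf_apply (br X Y) f) = v (vf_apply X (vf_apply Y f)) - v (vf_apply Y (vf_apply X f))"
proof -
  obtain U where U: "open U" "p \<in> U" "smooth_fun_on A U f"
    using f unfolding smooth_near_def by blast
  have "v (vf_apply (br X Y) f) = v (\<lambda>q. vf_apply X (vf_apply Y f) q - vf_apply Y (vf_apply X f) q)"
  proof (rule tangent_vec_cong[OF v U(1,2)])
    fix q assume "q \<in> U"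
    then have "smooth_near A q f" using smooth_nearI[OF U(1) _ U(3)] by blast
    then show "vf_apply (br X Y) f q = vf_apply X (vf_apply Y f) q - vf_apply Y (vf_apply X f) q"
      using lie_bracket_apply[of q f X Y] by (simp only: vf_apply_def)
  qed
  also have "\<dots> = v (vf_apply X (vf_apply Y f)) - v (vf_apply Y (vf_apply X f))"
    by (intro tangent_vec_diff[OF v] smooth_near_vf_apply XY f)
  finally show ?thesis .
qed

text \<open>Written as a Leibniz rule for the bracket with \<open>X\<close>, to match the Killing
  equation. On functions smooth near \<open>p\<close> it is a comparison of iterated derivatives; on
  all others both sides vanish.\<close>

lemma jacobi:
  assumes "X \<in> VF" "Y \<in> VF" "Z \<in> VF"
  shows "br X (br Y Z) = vf_add (br (br X Y) Z) (br Y (br X Z))"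
proof (intro ext)
  fix p f
  show "br X (br Y Z) p f = vf_add (br (br X Y) Z) (br Y (br X Z)) p f"
  proof (cases "smooth_near A p f")
    case True
    then show ?thesis
      using assms by (simp add: vf_add_def lie_bracket_apply smooth_near_vf_apply
          tangent_vec_lie_bracket[OF vector_fieldsD])
  qed (simp add: lie_bracket_def vf_add_def)
qed

section \<open>Tensoriality of the curvature in its first argument\<close>

lemma curvature_add_left:
  "X \<in> VF \<Longrightarrow> X' \<in> VF \<Longrightarrow> Y \<in> VF \<Longrightarrow> Z \<in> VF \<Longrightarrow> R (vf_add X X') Y Z = vf_add (R X Y Z) (R X' Y Z)"
  unfolding curvature_def
  by (simp add: vf_closed nabla_add_left nabla_add_right lie_bracket_add_left)
    (simp add: vf_add_def vf_diff_def fun_eq_iff)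

text \<open>The term with \<open>Y(g)\<close> from differentiating \<open>g * nabla X Z\<close>
  along \<open>Y\<close> cancels the one from the bracket of \<open>g * X\<close> with
  \<open>Y\<close>. The first slot is the one over which the Ricci trace runs.\<close>

lemma curvature_scale_left:
  "g \<in> smooth_funs A \<Longrightarrow> X \<in> VF \<Longrightarrow> Y \<in> VF \<Longrightarrow> Z \<in> VF \<Longrightarrow>
    R (vf_scale g X) Y Z = vf_scale g (R X Y Z)"
  unfolding curvature_def
  by (simp add: vf_closed nabla_scale_left nabla_scale_right lie_bracket_scale_left nabla_diff_left
      vf_apply_smooth_funs)
    (simp add: vf_add_def vf_diff_def vf_scale_def fun_eq_iff algebra_simps)

section \<open>Leibniz rules along an affine Killing field\<close>

lemma affine_killing_nabla:
  assumes "X \<in> affine_killing A nabla" "Y \<in> VF" "Z \<in> VF"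
  shows "br X (nabla Y Z) = vf_add (nabla (br X Y) Z) (nabla Y (br X Z))"
proof -
  have "lie_derivative_conn A nabla X Y Z = vf_zero"
    using assms unfolding affine_killing_def by blast
  then show ?thesis
    unfolding lie_derivative_conn_def vf_diff_def vf_add_def vf_zero_def fun_eq_iff
    by (simp add: algebra_simps)
qed

text \<open>The Killing equation is a Leibniz rule for \<open>nabla\<close>. Applying it to the
  iterated derivatives, and together with \<open>jacobi\<close> to the term with
  \<open>br U Y\<close>, gives the Leibniz rule for \<open>R\<close>.\<close>

lemma affine_killing_curvature:
  assumes X: "X \<in> affine_killing A nabla" and VF: "U \<in> VF" "Y \<in> VF" "Z \<in> VF"
  shows "br X (R U Y Z) = vf_add (R (br X U) Y Z) (vf_add (R U (br X Y) Z) (R U Y (br X Z)))"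
proof -
  have XVF: "X \<in> VF" using X unfolding affine_killing_def by blast
  note closed = XVF VF vf_closed
  \<comment> \<open>\<open>V\<close> and \<open>W\<close> stay generic so that the rule covers both
    orders of \<open>U\<close> and \<open>Y\<close>.\<close>
  have "br X (nabla V (nabla W Z)) =
      vf_add (nabla (br X V) (nabla W Z)) (vf_add (nabla V (nabla (br X W) Z)) (nabla V (nabla W (br X Z))))"
    if "V \<in> VF" "W \<in> VF" for V W
    using that by (simp add: affine_killing_nabla[OF X] closed nabla_add_right)
  moreover have "br X (nabla (br U Y) Z) =
      vf_add (vf_add (nabla (br (br X U) Y) Z) (nabla (br U (br X Y)) Z)) (nabla (br U Y) (br X Z))"
    by (simp add: affine_killing_nabla[OF X] closed jacobi[OF XVF VF(1,2)] nabla_add_left)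
  ultimately show ?thesis
    unfolding curvature_def
    by (simp add: closed lie_bracket_diff_right)
      (simp add: vf_add_def vf_diff_def fun_eq_iff)
qed

lemma hessian_conv: "hessian nabla f X Y p = X p (vf_apply Y f) - nabla X Y p f"
  by (simp add: hessian_def dual_conn_def differential_def vf_apply_def)

text \<open>Commuting \<open>X\<close> past \<open>Y\<close> and \<open>Z\<close> in the second
  derivative produces bracket terms; the Killing equation supplies the matching corrections for
  \<open>nabla Y Z\<close>.\<close>

lemma affine_killing_hessian:
  assumes X: "X \<in> affine_killing A nabla" and VF: "Y \<in> VF" "Z \<in> VF" and f: "f \<in> smooth_funs A"
  shows "X p (hessian nabla f Y Z) =
    hessian nabla (vf_apply X f) Y Z p + hessian nabla f (br X Y) Z p + hessian nabla f Y (br X Z) p"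
proof -
  have XVF: "X \<in> VF" using X unfolding affine_killing_def by blast
  have near: "smooth_near A q f" for q using f by auto
  have "hessian nabla f Y Z = (\<lambda>q. vf_apply Y (vf_apply Z f) q - vf_apply (nabla Y Z) f q)"
    by (rule ext) (simp add: hessian_conv vf_apply_def)
  then have "X p (hessian nabla f Y Z) = X p (vf_apply Y (vf_apply Z f)) - X p (vf_apply (nabla Y Z) f)"
    by (simp only:) (intro tangent_vec_diff[OF vector_fieldsD[OF XVF]] smooth_near_vf_apply near XVF VF nabla_vector_fields)
  moreover have "X p (vf_apply (nabla Y Z) f) =
      nabla (br X Y) Z p f + nabla Y (br X Z) p f + nabla Y Z p (vf_apply X f)"
    using lie_bracket_apply[OF near[of p], of X "nabla Y Z"]
    by (simp add: affine_killing_nabla[OF X VF] vf_add_def)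
  moreover have "br X Y p (vf_apply Z f) = X p (vf_apply Y (vf_apply Z f)) - Y p (vf_apply X (vf_apply Z f))"
    by (intro lie_bracket_apply smooth_near_vf_apply near VF)
  moreover have "Y p (vf_apply (br X Z) f) = Y p (vf_apply X (vf_apply Z f)) - Y p (vf_apply Z (vf_apply X f))"
    by (rule tangent_vec_lie_bracket[OF vector_fieldsD[OF VF(1)] XVF VF(2) near])
  ultimately show ?thesis by (simp add: hessian_conv)
qed

section \<open>The Ricci trace in a fixed frame\<close>

lemma ricci_frame:
  assumes c: "c \<in> A" and V: "V \<subseteq> dom_chart c" "q \<in> V" and E: "\<And>i. E i \<in> VF"
    and curv: "\<And>X f. X \<in> VF \<Longrightarrow> R X Y Z q f = (\<Sum>i\<in>UNIV. X q (coord_fun c i) * R (E i) Y Z q f)"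
    and YZ: "Y \<in> VF" "Z \<in> VF"
  shows "ricci A nabla Y Z q = (\<Sum>i\<in>UNIV. R (E i) Y Z q (coord_fun c i))"
proof -
  define d where "d = (SOME d. d \<in> A \<and> q \<in> dom_chart d)"
  have d: "d \<in> A" "q \<in> dom_chart d"
    using chart_at[of q] someI_ex[of "\<lambda>d. d \<in> A \<and> q \<in> dom_chart d"] unfolding d_def by metis+
  have "ricci A nabla Y Z q = (\<Sum>k\<in>UNIV. R (extend A q (coord_vec A d k q)) Y Z q (coord_fun d k))"
    by (simp add: ricci_def tangent_trace_def Let_def d_def)
  \<comment> \<open>By \<open>curv\<close> the arbitrary extensions enter only through their values
    at \<open>q\<close>.\<close>
  also have "\<dots> = (\<Sum>k\<in>UNIV. \<Sum>i\<in>UNIV. coord_vec A d k q (coord_fun c i) * R (E i) Y Z q (coord_fun d k))"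
    using extend[OF coord_vec_tangent[OF d]] by (simp add: curv)
  also have "\<dots> = (\<Sum>i\<in>UNIV. \<Sum>k\<in>UNIV. R (E i) Y Z q (coord_fun d k) * coord_vec A d k q (coord_fun c i))"
    by (subst sum.swap) (simp add: mult.commute)
  \<comment> \<open>For fixed \<open>i\<close> the sum over \<open>k\<close> is the expansion in
    \<open>d\<close> of the vector \<open>R (E i) Y Z q\<close>, applied to a coordinate function of
    \<open>c\<close>. This removes the arbitrary chart.\<close>
  also have "\<dots> = (\<Sum>i\<in>UNIV. R (E i) Y Z q (coord_fun c i))"
    by (intro sum.cong refl tangent_space_coord[symmetric] d vector_fieldsD curvature_vector_fields E YZ)
  finally show ?thesis .
qed

text \<open>Tensoriality is applied to the global decomposition of \<open>vf_scale \<psi> X\<close>,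
  and \<open>\<psi> = 1\<close> on \<open>V\<close> removes the cut-off. One frame serves all points
  of \<open>V\<close>.\<close>

lemma curvature_frame_exists:
  assumes c: "c \<in> A" "p \<in> dom_chart c"
  obtains V E where "open V" "p \<in> V" "V \<subseteq> dom_chart c" "\<And>i. E i \<in> VF"
    and "\<And>i q. q \<in> V \<Longrightarrow> E i q = coord_vec A c i q"
    and "\<And>X Y Z q f. X \<in> VF \<Longrightarrow> Y \<in> VF \<Longrightarrow> Z \<in> VF \<Longrightarrow> q \<in> V \<Longrightarrow>
      R X Y Z q f = (\<Sum>i\<in>UNIV. X q (coord_fun c i) * R (E i) Y Z q f)"
proof -
  obtain V and E :: "2 \<Rightarrow> 'a vfield" and \<psi> and a :: "'a vfield \<Rightarrow> 2 \<Rightarrow> 'a \<Rightarrow> real"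
    where V: "open V" "p \<in> V" "V \<subseteq> dom_chart c"
    and E: "\<And>i. E i \<in> VF" "\<And>i q. q \<in> V \<Longrightarrow> E i q = coord_vec A c i q"
    and \<psi>: "\<psi> \<in> smooth_funs A" "\<And>q. q \<in> V \<Longrightarrow> \<psi> q = 1"
    and a: "\<And>X i. X \<in> VF \<Longrightarrow> a X i \<in> smooth_funs A"
      "\<And>X i q. q \<in> V \<Longrightarrow> a X i q = X q (coord_fun c i)"
    and dec: "\<And>X. X \<in> VF \<Longrightarrow> vf_scale \<psi> X = vf_add (vf_scale (a X 1) (E 1)) (vf_scale (a X 2) (E 2))"
    by (rule local_frame_exists[OF c]) blast
  have "R X Y Z q f = (\<Sum>i\<in>UNIV. X q (coord_fun c i) * R (E i) Y Z q f)"
    if VF: "X \<in> VF" "Y \<in> VF" "Z \<in> VF" and q: "q \<in> V" for X Y Z q f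
  proof -
    have "vf_scale \<psi> (R X Y Z) = R (vf_scale \<psi> X) Y Z"
      by (rule curvature_scale_left[OF \<psi>(1) VF, symmetric])
    also have "\<dots> = vf_add (vf_scale (a X 1) (R (E 1) Y Z)) (vf_scale (a X 2) (R (E 2) Y Z))"
      unfolding dec[OF VF(1)]
      by (simp add: curvature_add_left curvature_scale_left vf_scale_vector_fields a(1) VF E(1))
    finally have "vf_scale \<psi> (R X Y Z) q f =
        vf_add (vf_scale (a X 1) (R (E 1) Y Z)) (vf_scale (a X 2) (R (E 2) Y Z)) q f" by (rule arg_cong)
    then show ?thesis by (simp add: vf_scale_def vf_add_def \<psi>(2)[OF q] a(2)[OF q] sum_2)
  qed
  with V E show ?thesis by (rule that)
qed

text \<open>The choices in \<open>ricci\<close> are made separately at each point, so smoothness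
  becomes visible only after rewriting it near \<open>p\<close> in one fixed frame.\<close>

lemma smooth_near_ricci:
  assumes YZ: "Y \<in> VF" "Z \<in> VF"
  shows "smooth_near A p (ricci A nabla Y Z)"
proof -
  obtain c where c: "c \<in> A" "p \<in> dom_chart c" by (rule chart_at)
  obtain V E where V: "open V" "p \<in> V" "V \<subseteq> dom_chart c" and E: "\<And>i. E i \<in> VF"
    and curv: "\<And>X Y Z q f. X \<in> VF \<Longrightarrow> Y \<in> VF \<Longrightarrow> Z \<in> VF \<Longrightarrow> q \<in> V \<Longrightarrow>
      R X Y Z q f = (\<Sum>i\<in>UNIV. X q (coord_fun c i) * R (E i) Y Z q f)"
    by (rule curvature_frame_exists[OF c]) blast
  show ?thesis
  proof (rule smooth_near_cong[OF V(1,2)])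
    show "(\<Sum>i\<in>UNIV. vf_apply (R (E i) Y Z) (coord_fun c i) q) = ricci A nabla Y Z q" if "q \<in> V" for q
      unfolding vf_apply_def
      by (rule ricci_frame[OF c(1) V(3) that E _ YZ, symmetric]) (rule curv[OF _ YZ that])
    show "smooth_near A p (\<lambda>q. \<Sum>i\<in>UNIV. vf_apply (R (E i) Y Z) (coord_fun c i) q)"
      by (intro smooth_near_sum smooth_near_vf_apply curvature_vector_fields E YZ
          smooth_near_coord_fun c) simp
  qed
qed

text \<open>In the trace of \<open>[X, R(E\<^sub>i, Y)Z]\<close> the terms coming from \<open>[X, E\<^sub>i]\<close> cancel against those coming from
  differentiating the coordinate functions along \<open>X\<close>.\<close>

lemma affine_killing_ricci:
  assumes X: "X \<in> affine_killing A nabla" and YZ: "Y \<in> VF" "Z \<in> VF"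
  shows "X p (ricci A nabla Y Z) = ricci A nabla (br X Y) Z p + ricci A nabla Y (br X Z) p"
proof -
  obtain c where c: "c \<in> A" "p \<in> dom_chart c" by (rule chart_at)
  obtain V E where V: "open V" "p \<in> V" "V \<subseteq> dom_chart c" and E: "\<And>i. E i \<in> VF"
    and EV: "\<And>i q. q \<in> V \<Longrightarrow> E i q = coord_vec A c i q"
    and curv: "\<And>X Y Z q f. X \<in> VF \<Longrightarrow> Y \<in> VF \<Longrightarrow> Z \<in> VF \<Longrightarrow> q \<in> V \<Longrightarrow>
      R X Y Z q f = (\<Sum>i\<in>UNIV. X q (coord_fun c i) * R (E i) Y Z q f)"
    by (rule curvature_frame_exists[OF c]) blast
  have XVF: "X \<in> VF" using X unfolding affine_killing_def by blast
  let ?x = "coord_fun c"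
  define W where "W i = R (E i) Y Z" for i
  have W: "W i \<in> VF" for i unfolding W_def by (intro curvature_vector_fields E YZ)
  have ric: "ricci A nabla Y' Z' q = (\<Sum>i\<in>UNIV. R (E i) Y' Z' q (?x i))"
    if "q \<in> V" "Y' \<in> VF" "Z' \<in> VF" for Y' Z' q
    by (rule ricci_frame[OF c(1) V(3) that(1) E _ that(2,3)]) (rule curv[OF _ that(2,3,1)])
  have x: "smooth_near A p (?x i)" for i by (rule smooth_near_coord_fun[OF c])
  have Wx: "smooth_near A p (vf_apply (W i) (?x i))" for i
    by (rule smooth_near_vf_apply[OF W x])
  let ?S = "\<lambda>q. vf_apply (W 1) (?x 1) q + vf_apply (W 2) (?x 2) q"
  have S: "?S q = ricci A nabla Y Z q" if "q \<in> V" for q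
    using ric[OF that YZ] by (simp add: sum_2 W_def vf_apply_def)
  have Xp: "X p \<in> tangent_space A p" by (rule vector_fieldsD[OF XVF])
  \<comment> \<open>\<open>E i\<close> applied to \<open>?x j\<close> is constant on
    \<open>V\<close>, so \<open>X\<close> annihilates it and only one half of the commutator
    survives.\<close>
  have XE: "br X (E i) p (?x j) = - coord_vec A c i p (vf_apply X (?x j))" for i j
  proof -
    have "X p (vf_apply (E i) (?x j)) = X p (\<lambda>_. if i = j then 1 else 0)"
      by (rule tangent_vec_cong[OF Xp V(1,2)])
        (use V(3) in \<open>auto simp: vf_apply_def EV coord_vec_coord_fun[OF c(1)]\<close>)
    also have "\<dots> = 0" by (rule tangent_vec_const[OF Xp])
    finally show ?thesis using lie_bracket_apply[OF x[of j], of X "E i"] by (simp add: EV[OF V(2)])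
  qed
  \<comment> \<open>The first sum over \<open>j\<close> expands \<open>W i\<close> applied to
    \<open>vf_apply X (?x i)\<close>; the second comes from \<open>br X (E i)\<close> in the first
    slot of the curvature.\<close>
  have XW: "X p (vf_apply (W i) (?x i)) = R (E i) (br X Y) Z p (?x i) + R (E i) Y (br X Z) p (?x i)
      + (\<Sum>j\<in>UNIV. W i p (?x j) * coord_vec A c j p (vf_apply X (?x i)))
      - (\<Sum>j\<in>UNIV. coord_vec A c i p (vf_apply X (?x j)) * W j p (?x i))" for i
  proof -
    have "X p (vf_apply (W i) (?x i)) = br X (W i) p (?x i) + W i p (vf_apply X (?x i))"
      using lie_bracket_apply[OF x[of i], of X "W i"] by simp
    also have "br X (W i) p (?x i) = R (br X (E i)) Y Z p (?x i) + R (E i) (br X Y) Z p (?x i)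
        + R (E i) Y (br X Z) p (?x i)"
      unfolding W_def affine_killing_curvature[OF X E YZ] by (simp add: vf_add_def)
    also have "R (br X (E i)) Y Z p (?x i) = (\<Sum>j\<in>UNIV. br X (E i) p (?x j) * W j p (?x i))"
      unfolding W_def by (intro curv lie_bracket_vector_fields XVF E YZ V)
    also have "W i p (vf_apply X (?x i)) = (\<Sum>j\<in>UNIV. W i p (?x j) * coord_vec A c j p (vf_apply X (?x i)))"
      by (intro tangent_space_coord c vector_fieldsD W)
    finally show ?thesis by (simp add: XE sum_negf)
  qed
  have "X p (ricci A nabla Y Z) = X p ?S"
    by (rule tangent_vec_cong[OF Xp V(1,2) S[symmetric]])
  also have "\<dots> = X p (vf_apply (W 1) (?x 1)) + X p (vf_apply (W 2) (?x 2))"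
    by (rule tangent_vec_add[OF Xp Wx Wx])
  \<comment> \<open>Summed over \<open>i\<close>, the two double sums agree after exchanging
    \<open>i\<close> and \<open>j\<close>, hence cancel.\<close>
  also have "\<dots> = ricci A nabla (br X Y) Z p + ricci A nabla Y (br X Z) p"
    unfolding XW by (simp add: ric V(2) YZ lie_bracket_vector_fields XVF sum_2)
  finally show ?thesis .
qed

lemma affine_killing_ricci_sym:
  assumes X: "X \<in> affine_killing A nabla" and YZ: "Y \<in> VF" "Z \<in> VF"
  shows "X p (ricci_sym A nabla Y Z) = ricci_sym A nabla (br X Y) Z p + ricci_sym A nabla Y (br X Z) p"
proof -
  have Xp: "X p \<in> tangent_space A p" using X vector_fieldsD unfolding affine_killing_def by blast
  note yz = smooth_near_ricci[OF YZ] affine_killing_ricci[OF X YZ]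
    and zy = smooth_near_ricci[OF YZ(2,1)] affine_killing_ricci[OF X YZ(2,1)]
  have "ricci_sym A nabla Y Z = (\<lambda>q. (1 / 2) * (ricci A nabla Y Z q + ricci A nabla Z Y q))"
    by (simp add: ricci_sym_def fun_eq_iff)
  then have "X p (ricci_sym A nabla Y Z) = (1 / 2) * (X p (ricci A nabla Y Z) + X p (ricci A nabla Z Y))"
    by (simp only: tangent_vec_cmult[OF Xp smooth_near_add[OF yz(1) zy(1)]]
        tangent_vec_add[OF Xp yz(1) zy(1)])
  then show ?thesis unfolding yz(2) zy(2) by (simp add: ricci_sym_def field_simps)
qed

lemma affine_killing_soliton:
  assumes f: "f \<in> ricci_soliton_potentials A nabla" and X: "X \<in> affine_killing A nabla"
  shows "vf_apply X f \<in> ker_hessian A nabla"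
proof -
  have XVF: "X \<in> VF" using X unfolding affine_killing_def by blast
  have fs: "f \<in> smooth_funs A"
    and sol: "\<And>Y Z q. Y \<in> VF \<Longrightarrow> Z \<in> VF \<Longrightarrow> hessian nabla f Y Z q = (- 1) * ricci_sym A nabla Y Z q"
    using f unfolding ricci_soliton_potentials_def by (auto simp: eq_neg_iff_add_eq_0)
  have "hessian nabla (vf_apply X f) Y Z p = 0" if YZ: "Y \<in> VF" "Z \<in> VF" for Y Z p
  proof -
    have Xp: "X p \<in> tangent_space A p" by (rule vector_fieldsD[OF XVF])
    have "ricci_sym A nabla Y Z = (\<lambda>q. (- 1) * hessian nabla f Y Z q)"
      using sol[OF YZ] by (simp add: fun_eq_iff)
    moreover have "smooth_near A p (hessian nabla f Y Z)"
    proof -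
      have "smooth_near A p (\<lambda>q. vf_apply Y (vf_apply Z f) q - vf_apply (nabla Y Z) f q)"
        by (intro smooth_near_diff smooth_near_vf_apply nabla_vector_fields YZ smooth_funs_imp_near fs)
      then show ?thesis by (simp add: hessian_conv[abs_def] vf_apply_def)
    qed
    ultimately have "X p (ricci_sym A nabla Y Z) = (- 1) * X p (hessian nabla f Y Z)"
      using tangent_vec_cmult[OF Xp] by (simp only:)
    \<comment> \<open>The soliton equation for the pairs \<open>br X Y, Z\<close> and
      \<open>Y, br X Z\<close> removes all bracket terms, leaving the Hessian of
      \<open>vf_apply X f\<close>.\<close>
    then show ?thesis
      unfolding affine_killing_hessian[OF X YZ fs] affine_killing_ricci_sym[OF X YZ]
      using sol[OF lie_bracket_vector_fields[OF XVF YZ(1)] YZ(2), of p]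
        sol[OF YZ(1) lie_bracket_vector_fields[OF XVF YZ(2)], of p] by simp
  qed
  with vf_apply_smooth_funs[OF XVF fs] show ?thesis unfolding ker_hessian_def by blast
qed

lemma ker_hessian_curvature_form:
  assumes h: "h \<in> ker_hessian A nabla" and VF: "X \<in> VF" "Y \<in> VF" "Z \<in> VF"
  shows "curvature_form A nabla X Y (differential h) Z p = 0"
proof -
  \<comment> \<open>As an equality of functions this can be substituted under a further derivative,
    which then acts on a constant. It also disposes of the term with \<open>br X Y\<close>.\<close>
  have dual: "dual_conn nabla U (differential h) W = (\<lambda>_. 0)" if "U \<in> VF" "W \<in> VF" for U W
    using h that unfolding ker_hessian_def hessian_def by blast
  show ?thesis
    unfolding curvature_form_def dual_conn_def[of nabla _ "dual_conn _ _ _"]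
    by (simp add: dual VF vf_closed vf_apply_def tangent_vec_const[OF vector_fieldsD])
qed

end

theorem lemma4p1:
  fixes A :: "'a::{t2_space,second_countable_topology} chart set"
    and nabla :: "'a conn"
  assumes "affine_surface A nabla"
  shows "(\<forall>f\<in>ricci_soliton_potentials A nabla. \<forall>X\<in>affine_killing A nabla.
            vf_apply X f \<in> ker_hessian A nabla) \<and>
         (\<forall>h\<in>ker_hessian A nabla. \<forall>c\<in>A. \<forall>i j :: nat. 1 \<le> i \<and> i < j \<and> j \<le> 2 \<longrightarrow>
            (\<forall>Z\<in>vector_fields A. \<forall>p\<in>dom_chart c.
               curvature_form_coord A nabla c (of_nat i) (of_nat j) (differential h) Z p = 0))"
proof -
  interpret affine_connection A nabla
    using assms unfolding affine_surface_def by unfold_locales auto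
  \<comment> \<open>Proved for arbitrary indices of type \<open>2\<close>, so the casts
    \<open>of_nat i\<close> and \<open>of_nat j\<close> need not be evaluated.\<close>
  have "curvature_form_coord A nabla c i j (differential h) Z p = 0"
    if "h \<in> ker_hessian A nabla" "c \<in> A" "Z \<in> VF" "p \<in> dom_chart c" for h c i j Z p
    unfolding curvature_form_coord_def
    by (intro ker_hessian_curvature_form that extend(1) coord_vec_tangent)
  then show ?thesis using affine_killing_soliton by blast
qed

end
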